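(* Let $\mathfrak g$ be a Kac--Moody algebra and $\lambda\in\mathfrak h^*$. The following invariants of a highest weight $\mathfrak g$-module $V$ of highest weight $\lambda$ determine one another: (1) the integrability $I_V=\{i\in I: f_i\text{ acts locally nilpotently on }V\}$; (2) the convex hull of the weights of $V$; (3) the stabilizer of the character of $V$ in the Weyl group $W$. That is, two $\mathfrak g$-modules of highest weight $\lambda$ share one of these invariants if and only if they share each of the others. Explicitly, for every such $V$ the convex hull of $\operatorname{wt}V$ equals the convex hull of $\operatorname{wt}M(\lambda,I_V)$, where $M(\lambda,I_V)$ is the parabolic Verma module, and the stabilizer of the character of $V$ in $W$ is the parabolic subgroup $W_{I_V}$.
   Context: Let $I$ be a finite set, $A=(a_{ij})_{i,j\in I}$ a generalized Cartan matrix, and $(\mathfrak h,\{\alpha_i\},\{\check\alpha_i\})$ a realization over $\mathbb C$, i.e. $\dim\mathfrak h=2|I|-\operatorname{rk}A$, with linearly independent simple roots $\alpha_i\in\mathfrak h^*$ and linearly independent simple coroots $\check\alpha_i\in\mathfrak h$ with $\langle\check\alpha_i,\alpha_j\rangle=a_{ij}$. $\mathfrak g=\mathfrak g(A)$ is the Lie algebra generated by $\mathfrak h$ and $e_i,f_i$ ($i\in I$) with relations $[\mathfrak h,\mathfrak h]=0$, $[h,e_i]=\langle h,\alpha_i\rangle e_i$, $[h,f_i]=-\langle h,\alpha_i\rangle f_i$, $[e_i,f_j]=\delta_{ij}\check\alpha_i$ and the Serre relations $(\operatorname{ad}e_i)^{1-a_{ij}}e_j=0=(\operatorname{ad}f_i)^{1-a_{ij}}f_j$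 for $i\ne j$. For an $\mathfrak h$-module $M$, $M_\mu=\{m: hm=\langle h,\mu\rangle m\ \forall h\in\mathfrak h\}$ and $\operatorname{wt}M=\{\mu: M_\mu\neq0\}$; convex hulls are taken over $\mathbb R$ in $\mathfrak h^*$. The character of $V$ is $\sum_\mu \dim V_\mu\, e^\mu$, and $W$ acts by $we^\mu=e^{w\mu}$. $W$ is the Weyl group generated by $s_i\mu=\mu-\langle\check\alpha_i,\mu\rangle\alpha_i$ ($i\in I$) and $W_J$ is the subgroup generated by $s_j$, $j\in J$. $M(\lambda)$ is the Verma module of highest weight $\lambda$. For $J\subset\{i\in I:\langle\check\alpha_i,\lambda\rangle\in\mathbb Z^{\geqslant0}\}$, the parabolic Verma module $M(\lambda,J)$ is the quotient of $M(\lambda)$ by the submodule generated by $f_j^{\langle\check\alpha_j,\lambda\rangle+1}M(\lambda)_\lambda$, $j\in J$. (For $V$ of highest weight $\lambda$, $I_V$ is always contained in $\{i:\langle\check\alpha_i,\lambda\rangle\in\mathbb Z^{\geqslant0}\}$.) *)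

theory Defs
  imports
    "HOL-Analysis.Analysis"
    "HOL-Library.Function_Algebras"
    "HOL-Algebra.Bij"
    "HOL-Algebra.Generated_Groups"
begin

text \<open>
  Weights are functions from the Cartan subalgebra to the complex numbers. They carry the pointwise
  real vector space structure, so that \<^term>\<open>convex hull S\<close> is the library's
  convex hull over the reals.
\<close>

instantiation "fun" :: (type, real_vector) real_vector
begin

definition scaleR_fun :: "real \<Rightarrow> ('a \<Rightarrow> 'b) \<Rightarrow> 'a \<Rightarrow> 'b" where
  "scaleR_fun r f = (\<lambda>x. r *\<^sub>R f x)"

instance
  by standard (auto simp: scaleR_fun_def fun_eq_iff scaleR_add_right scaleR_add_left)

end

definition fscale :: "complex \<Rightarrow> ('a \<Rightarrow> complex) \<Rightarrow> 'a \<Rightarrow> complex" where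
  "fscale c f = (\<lambda>x. c * f x)"

definition dual :: "(complex \<Rightarrow> 'h \<Rightarrow> 'h::ab_group_add) \<Rightarrow> ('h \<Rightarrow> complex) set" where
  "dual sh = {\<mu>. Vector_Spaces.linear sh (*) \<mu>}"


section \<open>Generalized Cartan matrices and realizations\<close>

locale generalized_cartan_matrix =
  fixes I :: "'i set" and A :: "'i \<Rightarrow> 'i \<Rightarrow> int"
  assumes finite_I: "finite I"
    and diag: "i \<in> I \<Longrightarrow> A i i = 2"
    and off_diag: "i \<in> I \<Longrightarrow> j \<in> I \<Longrightarrow> i \<noteq> j \<Longrightarrow> A i j \<le> 0"
    and zero_sym: "i \<in> I \<Longrightarrow> j \<in> I \<Longrightarrow> A i j = 0 \<Longrightarrow> A j i = 0"

text \<open>The dimension of the row space of the \<open>I \<times> I\<close> matrix; entries outside \<open>I\<close> are ignored.\<close>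

definition matrix_rank :: "'i set \<Rightarrow> ('i \<Rightarrow> 'i \<Rightarrow> int) \<Rightarrow> nat" where
  "matrix_rank I A =
     vector_space.dim fscale ((\<lambda>i j. if j \<in> I then complex_of_int (A i j) else 0) ` I)"

text \<open>\<open>\<alpha> j (\<alpha>v i)\<close> is the pairing of the \<open>i\<close>-th simple coroot with the \<open>j\<close>-th simple root.\<close>

locale realization =
  generalized_cartan_matrix I A + h: vector_space sh
  for I :: "'i set" and A :: "'i \<Rightarrow> 'i \<Rightarrow> int"
    and sh :: "complex \<Rightarrow> 'h \<Rightarrow> 'h::ab_group_add"
    and \<alpha> :: "'i \<Rightarrow> 'h \<Rightarrow> complex" and \<alpha>v :: "'i \<Rightarrow> 'h" +
  assumes dim_h: "\<exists>B. finite B \<and> h.independent B \<and> h.span B = UNIV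
                      \<and> card B = 2 * card I - matrix_rank I A"
    and roots_dual: "i \<in> I \<Longrightarrow> \<alpha> i \<in> dual sh"
    and roots_indep: "inj_on \<alpha> I" "\<not> module.dependent fscale (\<alpha> ` I)"
    and coroots_indep: "inj_on \<alpha>v I" "h.independent (\<alpha>v ` I)"
    and pairing: "i \<in> I \<Longrightarrow> j \<in> I \<Longrightarrow> \<alpha> j (\<alpha>v i) = of_int (A i j)"


section \<open>Lie algebras given by generators and relations\<close>

locale lie_algebra = vector_space sg
  for sg :: "complex \<Rightarrow> 'g \<Rightarrow> 'g::ab_group_add" and br :: "'g \<Rightarrow> 'g \<Rightarrow> 'g" +
  assumes br_add_left: "br (x + y) z = br x z + br y z"
    and br_add_right: "br x (y + z) = br x y + br x z"
    and br_scale_left: "br (sg c x) y = sg c (br x y)"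
    and br_scale_right: "br x (sg c y) = sg c (br x y)"
    and br_alternating: "br x x = 0"
    and jacobi: "br x (br y z) + br y (br z x) + br z (br x y) = 0"

datatype 'x lie_term =
    LGen 'x
  | LZero
  | LPlus "'x lie_term" "'x lie_term"
  | LScale complex "'x lie_term"
  | LBr "'x lie_term" "'x lie_term"

text \<open>
  The least congruence containing \<open>R\<close> for which the terms form a Lie algebra: the terms modulo
  \<open>lie_cong R\<close> are the Lie algebra generated by \<open>'x\<close> with relations \<open>R\<close>.
\<close>

inductive lie_cong :: "('x lie_term \<times> 'x lie_term) set \<Rightarrow> 'x lie_term \<Rightarrow> 'x lie_term \<Rightarrow> bool"
  for R where
  rel: "(s, t) \<in> R \<Longrightarrow> lie_cong R s t"
| refl: "lie_cong R t t"
| sym: "lie_cong R s t \<Longrightarrow> lie_cong R t s"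
| trans: "lie_cong R s t \<Longrightarrow> lie_cong R t u \<Longrightarrow> lie_cong R s u"
| plus: "lie_cong R s s' \<Longrightarrow> lie_cong R t t' \<Longrightarrow> lie_cong R (LPlus s t) (LPlus s' t')"
| scale: "lie_cong R t t' \<Longrightarrow> lie_cong R (LScale c t) (LScale c t')"
| br: "lie_cong R s s' \<Longrightarrow> lie_cong R t t' \<Longrightarrow> lie_cong R (LBr s t) (LBr s' t')"
| add_assoc: "lie_cong R (LPlus (LPlus s t) u) (LPlus s (LPlus t u))"
| add_comm: "lie_cong R (LPlus s t) (LPlus t s)"
| add_zero: "lie_cong R (LPlus LZero t) t"
| add_minus: "lie_cong R (LPlus t (LScale (- 1) t)) LZero"
| scale_plus: "lie_cong R (LScale c (LPlus s t)) (LPlus (LScale c s) (LScale c t))"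
| plus_scale: "lie_cong R (LScale (c + d) t) (LPlus (LScale c t) (LScale d t))"
| scale_scale: "lie_cong R (LScale c (LScale d t)) (LScale (c * d) t)"
| scale_one: "lie_cong R (LScale 1 t) t"
| br_plus_left: "lie_cong R (LBr (LPlus s t) u) (LPlus (LBr s u) (LBr t u))"
| br_plus_right: "lie_cong R (LBr s (LPlus t u)) (LPlus (LBr s t) (LBr s u))"
| br_scale_left: "lie_cong R (LBr (LScale c s) t) (LScale c (LBr s t))"
| br_scale_right: "lie_cong R (LBr s (LScale c t)) (LScale c (LBr s t))"
| br_alternating: "lie_cong R (LBr t t) LZero"
| jacobi: "lie_cong R (LPlus (LBr s (LBr t u)) (LPlus (LBr t (LBr u s)) (LBr u (LBr s t)))) LZero"

primrec lie_eval :: "(complex \<Rightarrow> 'g \<Rightarrow> 'g) \<Rightarrow> ('g \<Rightarrow> 'g \<Rightarrow> 'g) \<Rightarrow> ('x \<Rightarrow> 'g::ab_group_add)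
    \<Rightarrow> 'x lie_term \<Rightarrow> 'g" where
  "lie_eval sg br \<phi> (LGen x) = \<phi> x"
| "lie_eval sg br \<phi> LZero = 0"
| "lie_eval sg br \<phi> (LPlus s t) = lie_eval sg br \<phi> s + lie_eval sg br \<phi> t"
| "lie_eval sg br \<phi> (LScale c t) = sg c (lie_eval sg br \<phi> t)"
| "lie_eval sg br \<phi> (LBr s t) = br (lie_eval sg br \<phi> s) (lie_eval sg br \<phi> t)"

text \<open>
  The Lie algebra is, through \<open>\<phi>\<close>, the one generated by \<open>X\<close> with relations \<open>R\<close>: evaluation is onto
  and identifies exactly the terms that the relations identify. The relations only mention
  generators in \<open>X\<close>, so terms with other generators occurring inside a derivation are harmless.
\<close>

locale lie_presentation = lie_algebra sg br
  for X :: "'x set" and R :: "('x lie_term \<times> 'x lie_term) set"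
    and sg :: "complex \<Rightarrow> 'g \<Rightarrow> 'g::ab_group_add" and br :: "'g \<Rightarrow> 'g \<Rightarrow> 'g"
    and \<phi> :: "'x \<Rightarrow> 'g" +
  assumes generated: "\<exists>t. set_lie_term t \<subseteq> X \<and> lie_eval sg br \<phi> t = x"
    and eval_eq_iff: "set_lie_term s \<subseteq> X \<Longrightarrow> set_lie_term t \<subseteq> X \<Longrightarrow>
      lie_eval sg br \<phi> s = lie_eval sg br \<phi> t \<longleftrightarrow> lie_cong R s t"


section \<open>Kac--Moody algebras\<close>

datatype ('i, 'h) km_gen = HGen 'h | EGen 'i | FGen 'i

definition km_gens :: "'i set \<Rightarrow> ('i, 'h) km_gen set" where
  "km_gens I = range HGen \<union> EGen ` I \<union> FGen ` I"

text \<open>The first two families of relations say that \<open>\<hh>\<close> is taken as a vector space of generators.\<close>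

inductive_set km_rels :: "'i set \<Rightarrow> ('i \<Rightarrow> 'i \<Rightarrow> int) \<Rightarrow> (complex \<Rightarrow> 'h \<Rightarrow> 'h::ab_group_add)
    \<Rightarrow> ('i \<Rightarrow> 'h \<Rightarrow> complex) \<Rightarrow> ('i \<Rightarrow> 'h)
    \<Rightarrow> (('i, 'h) km_gen lie_term \<times> ('i, 'h) km_gen lie_term) set"
  for I A sh \<alpha> \<alpha>v where
  h_add: "(LGen (HGen (h + k)), LPlus (LGen (HGen h)) (LGen (HGen k))) \<in> km_rels I A sh \<alpha> \<alpha>v"
| h_scale: "(LGen (HGen (sh c h)), LScale c (LGen (HGen h))) \<in> km_rels I A sh \<alpha> \<alpha>v"
| h_h: "(LBr (LGen (HGen h)) (LGen (HGen k)), LZero) \<in> km_rels I A sh \<alpha> \<alpha>v"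
| h_e: "i \<in> I \<Longrightarrow>
    (LBr (LGen (HGen h)) (LGen (EGen i)), LScale (\<alpha> i h) (LGen (EGen i))) \<in> km_rels I A sh \<alpha> \<alpha>v"
| h_f: "i \<in> I \<Longrightarrow>
    (LBr (LGen (HGen h)) (LGen (FGen i)), LScale (- \<alpha> i h) (LGen (FGen i))) \<in> km_rels I A sh \<alpha> \<alpha>v"
| e_f: "i \<in> I \<Longrightarrow> j \<in> I \<Longrightarrow>
    (LBr (LGen (EGen i)) (LGen (FGen j)), if i = j then LGen (HGen (\<alpha>v i)) else LZero)
      \<in> km_rels I A sh \<alpha> \<alpha>v"
| serre_e: "i \<in> I \<Longrightarrow> j \<in> I \<Longrightarrow> i \<noteq> j \<Longrightarrow>
    ((LBr (LGen (EGen i)) ^^ nat (1 - A i j)) (LGen (EGen j)), LZero) \<in> km_rels I A sh \<alpha> \<alpha>v"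
| serre_f: "i \<in> I \<Longrightarrow> j \<in> I \<Longrightarrow> i \<noteq> j \<Longrightarrow>
    ((LBr (LGen (FGen i)) ^^ nat (1 - A i j)) (LGen (FGen j)), LZero) \<in> km_rels I A sh \<alpha> \<alpha>v"

locale kac_moody_algebra =
  realization I A sh \<alpha> \<alpha>v +
  lie_presentation "km_gens I" "km_rels I A sh \<alpha> \<alpha>v" sg br "case_km_gen H E F"
  for I :: "'i set" and A :: "'i \<Rightarrow> 'i \<Rightarrow> int"
    and sh :: "complex \<Rightarrow> 'h \<Rightarrow> 'h::ab_group_add"
    and \<alpha> :: "'i \<Rightarrow> 'h \<Rightarrow> complex" and \<alpha>v :: "'i \<Rightarrow> 'h"
    and sg :: "complex \<Rightarrow> 'g \<Rightarrow> 'g::ab_group_add" and br :: "'g \<Rightarrow> 'g \<Rightarrow> 'g"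
    and H :: "'h \<Rightarrow> 'g" and E :: "'i \<Rightarrow> 'g" and F :: "'i \<Rightarrow> 'g"


section \<open>Modules, weights, characters\<close>

locale lie_module = vector_space sV
  for sg :: "complex \<Rightarrow> 'g \<Rightarrow> 'g::ab_group_add" and br :: "'g \<Rightarrow> 'g \<Rightarrow> 'g"
    and sV :: "complex \<Rightarrow> 'v \<Rightarrow> 'v::ab_group_add" and act :: "'g \<Rightarrow> 'v \<Rightarrow> 'v" +
  assumes act_add_left: "act (x + y) v = act x v + act y v"
    and act_scale_left: "act (sg c x) v = sV c (act x v)"
    and act_add_right: "act x (v + w) = act x v + act x w"
    and act_scale_right: "act x (sV c v) = sV c (act x v)"
    and act_br: "act (br x y) v = act x (act y v) - act y (act x v)"

definition submodule ::
  "(complex \<Rightarrow> 'v \<Rightarrow> 'v::ab_group_add) \<Rightarrow> ('g \<Rightarrow> 'v \<Rightarrow> 'v) \<Rightarrow> 'v set \<Rightarrow> bool" where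
  "submodule sV act N \<longleftrightarrow> module.subspace sV N \<and> (\<forall>x. \<forall>v\<in>N. act x v \<in> N)"

definition weight_space :: "('h \<Rightarrow> 'g) \<Rightarrow> (complex \<Rightarrow> 'v \<Rightarrow> 'v::ab_group_add) \<Rightarrow> ('g \<Rightarrow> 'v \<Rightarrow> 'v)
    \<Rightarrow> ('h \<Rightarrow> complex) \<Rightarrow> 'v set" where
  "weight_space H sV act \<mu> = {v. \<forall>h. act (H h) v = sV (\<mu> h) v}"

definition wt :: "(complex \<Rightarrow> 'h \<Rightarrow> 'h::ab_group_add) \<Rightarrow> ('h \<Rightarrow> 'g)
    \<Rightarrow> (complex \<Rightarrow> 'v \<Rightarrow> 'v::ab_group_add) \<Rightarrow> ('g \<Rightarrow> 'v \<Rightarrow> 'v) \<Rightarrow> ('h \<Rightarrow> complex) set" where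
  "wt sh H sV act = {\<mu> \<in> dual sh. weight_space H sV act \<mu> \<noteq> {0}}"

text \<open>
  The formal sum \<open>\<Sum>\<mu>. dim V\<^sub>\<mu> e\<^sup>\<mu>\<close> is represented by its coefficient function, restricted to the dual
  of the Cartan subalgebra. The library's \<open>dim\<close> is 0 on infinite-dimensional spaces; weight spaces
  of highest weight modules are finite-dimensional, so this convention plays no role here.
\<close>

definition character :: "(complex \<Rightarrow> 'h \<Rightarrow> 'h::ab_group_add) \<Rightarrow> ('h \<Rightarrow> 'g)
    \<Rightarrow> (complex \<Rightarrow> 'v \<Rightarrow> 'v::ab_group_add) \<Rightarrow> ('g \<Rightarrow> 'v \<Rightarrow> 'v) \<Rightarrow> ('h \<Rightarrow> complex) \<Rightarrow> nat" where
  "character sh H sV act = (\<lambda>\<mu>\<in>dual sh. vector_space.dim sV (weight_space H sV act \<mu>))"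

definition integrability :: "'i set \<Rightarrow> ('i \<Rightarrow> 'g) \<Rightarrow> ('g \<Rightarrow> 'v \<Rightarrow> 'v::ab_group_add) \<Rightarrow> 'i set" where
  "integrability I F act = {i \<in> I. \<forall>v. \<exists>n. (act (F i) ^^ n) v = 0}"

locale highest_weight_module = lie_module sg br sV act
  for I :: "'i set"
    and sg :: "complex \<Rightarrow> 'g \<Rightarrow> 'g::ab_group_add" and br :: "'g \<Rightarrow> 'g \<Rightarrow> 'g"
    and H :: "'h \<Rightarrow> 'g" and E :: "'i \<Rightarrow> 'g" and \<Lambda> :: "'h \<Rightarrow> complex"
    and sV :: "complex \<Rightarrow> 'v \<Rightarrow> 'v::ab_group_add" and act :: "'g \<Rightarrow> 'v \<Rightarrow> 'v" +
  assumes highest_weight_vector: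
    "\<exists>v. v \<noteq> 0 \<and> (\<forall>i\<in>I. act (E i) v = 0) \<and> v \<in> weight_space H sV act \<Lambda>
         \<and> submodule sV act hull {v} = UNIV"


section \<open>The Weyl group\<close>

definition simple_reflection ::
  "(complex \<Rightarrow> 'h \<Rightarrow> 'h::ab_group_add) \<Rightarrow> ('i \<Rightarrow> 'h \<Rightarrow> complex) \<Rightarrow> ('i \<Rightarrow> 'h) \<Rightarrow> 'i
    \<Rightarrow> ('h \<Rightarrow> complex) \<Rightarrow> ('h \<Rightarrow> complex)" where
  "simple_reflection sh \<alpha> \<alpha>v i = (\<lambda>\<mu>\<in>dual sh. \<mu> - fscale (\<mu> (\<alpha>v i)) (\<alpha> i))"

text \<open>\<open>weyl_group sh \<alpha> \<alpha>v J\<close> is the parabolic subgroup \<open>W\<^sub>J\<close>; the Weyl group itself is \<open>J = I\<close>.\<close>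

definition weyl_group :: "(complex \<Rightarrow> 'h \<Rightarrow> 'h::ab_group_add) \<Rightarrow> ('i \<Rightarrow> 'h \<Rightarrow> complex)
    \<Rightarrow> ('i \<Rightarrow> 'h) \<Rightarrow> 'i set \<Rightarrow> (('h \<Rightarrow> complex) \<Rightarrow> ('h \<Rightarrow> complex)) set" where
  "weyl_group sh \<alpha> \<alpha>v J = generate (BijGroup (dual sh)) (simple_reflection sh \<alpha> \<alpha>v ` J)"

text \<open>\<open>w e\<^sup>\<mu> = e\<^bsup>w \<mu>\<^esup>\<close> means that the coefficient of \<open>e\<^sup>\<mu>\<close> in \<open>w ch\<close> is that of \<open>e\<^sup>\<nu>\<close> in \<open>ch\<close>, \<open>w \<nu> = \<mu>\<close>.\<close>

definition char_action :: "(complex \<Rightarrow> 'h \<Rightarrow> 'h::ab_group_add)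
    \<Rightarrow> (('h \<Rightarrow> complex) \<Rightarrow> ('h \<Rightarrow> complex)) \<Rightarrow> (('h \<Rightarrow> complex) \<Rightarrow> nat) \<Rightarrow> ('h \<Rightarrow> complex) \<Rightarrow> nat" where
  "char_action sh w ch = (\<lambda>\<mu>\<in>dual sh. ch (inv_into (dual sh) w \<mu>))"

definition char_stabilizer :: "'i set \<Rightarrow> (complex \<Rightarrow> 'h \<Rightarrow> 'h::ab_group_add)
    \<Rightarrow> ('i \<Rightarrow> 'h \<Rightarrow> complex) \<Rightarrow> ('i \<Rightarrow> 'h) \<Rightarrow> (('h \<Rightarrow> complex) \<Rightarrow> nat)
    \<Rightarrow> (('h \<Rightarrow> complex) \<Rightarrow> ('h \<Rightarrow> complex)) set" where
  "char_stabilizer I sh \<alpha> \<alpha>v ch = {w \<in> weyl_group sh \<alpha> \<alpha>v I. char_action sh w ch = ch}"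


section \<open>Verma and parabolic Verma modules\<close>

datatype 'g mod_term =
    MGen
  | MZero
  | MPlus "'g mod_term" "'g mod_term"
  | MScale complex "'g mod_term"
  | MAct 'g "'g mod_term"

text \<open>
  The least congruence containing \<open>R\<close> for which the terms form a module over the Lie algebra: for
  empty \<open>R\<close> the terms modulo \<open>mod_cong\<close> are the free module of rank one, that is, the universal
  enveloping algebra.
\<close>

inductive mod_cong :: "(complex \<Rightarrow> 'g \<Rightarrow> 'g::ab_group_add) \<Rightarrow> ('g \<Rightarrow> 'g \<Rightarrow> 'g)
    \<Rightarrow> ('g mod_term \<times> 'g mod_term) set \<Rightarrow> 'g mod_term \<Rightarrow> 'g mod_term \<Rightarrow> bool"
  for sg br R where
  rel: "(s, t) \<in> R \<Longrightarrow> mod_cong sg br R s t"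
| refl: "mod_cong sg br R t t"
| sym: "mod_cong sg br R s t \<Longrightarrow> mod_cong sg br R t s"
| trans: "mod_cong sg br R s t \<Longrightarrow> mod_cong sg br R t u \<Longrightarrow> mod_cong sg br R s u"
| plus: "mod_cong sg br R s s' \<Longrightarrow> mod_cong sg br R t t' \<Longrightarrow>
    mod_cong sg br R (MPlus s t) (MPlus s' t')"
| scale: "mod_cong sg br R t t' \<Longrightarrow> mod_cong sg br R (MScale c t) (MScale c t')"
| act: "mod_cong sg br R t t' \<Longrightarrow> mod_cong sg br R (MAct x t) (MAct x t')"
| add_assoc: "mod_cong sg br R (MPlus (MPlus s t) u) (MPlus s (MPlus t u))"
| add_comm: "mod_cong sg br R (MPlus s t) (MPlus t s)"
| add_zero: "mod_cong sg br R (MPlus MZero t) t"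
| add_minus: "mod_cong sg br R (MPlus t (MScale (- 1) t)) MZero"
| scale_plus: "mod_cong sg br R (MScale c (MPlus s t)) (MPlus (MScale c s) (MScale c t))"
| plus_scale: "mod_cong sg br R (MScale (c + d) t) (MPlus (MScale c t) (MScale d t))"
| scale_scale: "mod_cong sg br R (MScale c (MScale d t)) (MScale (c * d) t)"
| scale_one: "mod_cong sg br R (MScale 1 t) t"
| act_add_left: "mod_cong sg br R (MAct (x + y) t) (MPlus (MAct x t) (MAct y t))"
| act_scale_left: "mod_cong sg br R (MAct (sg c x) t) (MScale c (MAct x t))"
| act_add_right: "mod_cong sg br R (MAct x (MPlus s t)) (MPlus (MAct x s) (MAct x t))"
| act_scale_right: "mod_cong sg br R (MAct x (MScale c t)) (MScale c (MAct x t))"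
| act_br: "mod_cong sg br R (MAct (br x y) t)
    (MPlus (MAct x (MAct y t)) (MScale (- 1) (MAct y (MAct x t))))"

primrec mod_eval :: "(complex \<Rightarrow> 'v \<Rightarrow> 'v) \<Rightarrow> ('g \<Rightarrow> 'v \<Rightarrow> 'v) \<Rightarrow> 'v::ab_group_add
    \<Rightarrow> 'g mod_term \<Rightarrow> 'v" where
  "mod_eval sV act m MGen = m"
| "mod_eval sV act m MZero = 0"
| "mod_eval sV act m (MPlus s t) = mod_eval sV act m s + mod_eval sV act m t"
| "mod_eval sV act m (MScale c t) = sV c (mod_eval sV act m t)"
| "mod_eval sV act m (MAct x t) = act x (mod_eval sV act m t)"

definition verma_rels :: "'i set \<Rightarrow> ('h \<Rightarrow> 'g) \<Rightarrow> ('i \<Rightarrow> 'g) \<Rightarrow> ('h \<Rightarrow> complex)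
    \<Rightarrow> ('g mod_term \<times> 'g mod_term) set" where
  "verma_rels I H E \<Lambda> =
     {(MAct (E i) MGen, MZero) | i. i \<in> I} \<union> {(MAct (H h) MGen, MScale (\<Lambda> h) MGen) | h. True}"

text \<open>
  \<open>M(\<Lambda>)\<close> is the quotient of the universal enveloping algebra by the left ideal generated by the
  \<open>e\<^sub>i\<close> and the \<open>h - \<Lambda>(h)\<close>: evaluation at a suitable generator is onto and has exactly this kernel.
\<close>

locale verma_module = lie_module sg br sM act
  for I :: "'i set"
    and sg :: "complex \<Rightarrow> 'g \<Rightarrow> 'g::ab_group_add" and br :: "'g \<Rightarrow> 'g \<Rightarrow> 'g"
    and H :: "'h \<Rightarrow> 'g" and E :: "'i \<Rightarrow> 'g" and \<Lambda> :: "'h \<Rightarrow> complex"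
    and sM :: "complex \<Rightarrow> 'm \<Rightarrow> 'm::ab_group_add" and act :: "'g \<Rightarrow> 'm \<Rightarrow> 'm" +
  assumes presented:
    "\<exists>m. surj (mod_eval sM act m) \<and>
         (\<forall>s t. mod_eval sM act m s = mod_eval sM act m t
                \<longleftrightarrow> mod_cong sg br (verma_rels I H E \<Lambda>) s t)"

text \<open>
  The module with carrier \<open>'p\<close> is the quotient of the Verma module with carrier \<open>'m\<close> by the submodule
  generated by the vectors \<open>f\<^sub>j\<^bsup>n + 1\<^esup> m\<close>, where \<open>j \<in> J\<close>, \<open>n\<close> is the pairing of \<open>\<Lambda>\<close> with the
  \<open>j\<close>-th simple coroot, and \<open>m\<close> has weight \<open>\<Lambda>\<close>. Indices \<open>j\<close> at which \<open>\<Lambda>\<close> is not a nonnegative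
  integer contribute nothing.
\<close>

locale parabolic_verma_module =
  verma: verma_module I sg br H E \<Lambda> sM aM + lie_module sg br sP aP
  for I :: "'i set" and \<alpha>v :: "'i \<Rightarrow> 'h"
    and sg :: "complex \<Rightarrow> 'g \<Rightarrow> 'g::ab_group_add" and br :: "'g \<Rightarrow> 'g \<Rightarrow> 'g"
    and H :: "'h \<Rightarrow> 'g" and E :: "'i \<Rightarrow> 'g" and F :: "'i \<Rightarrow> 'g" and \<Lambda> :: "'h \<Rightarrow> complex"
    and J :: "'i set"
    and sM :: "complex \<Rightarrow> 'm \<Rightarrow> 'm::ab_group_add" and aM :: "'g \<Rightarrow> 'm \<Rightarrow> 'm"
    and sP :: "complex \<Rightarrow> 'p \<Rightarrow> 'p::ab_group_add" and aP :: "'g \<Rightarrow> 'p \<Rightarrow> 'p" +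
  assumes quotient:
    "\<exists>\<pi>. Vector_Spaces.linear sM sP \<pi> \<and> surj \<pi> \<and> (\<forall>x m. \<pi> (aM x m) = aP x (\<pi> m)) \<and>
         {m. \<pi> m = 0} =
           submodule sM aM hull
             {(aM (F j) ^^ (n + 1)) m | j n m.
                j \<in> J \<and> \<Lambda> (\<alpha>v j) = of_nat n \<and> m \<in> weight_space H sM aM \<Lambda>}"

end

theory Submission
  imports Defs
begin

text \<open>
  Let \<open>J = I\<^sub>V\<close>. By \<open>sl\<^sub>2\<close>-theory the character of \<open>V\<close> is invariant under \<open>W\<^sub>J\<close>, and \<open>\<Lambda> - n \<alpha>\<^sub>i\<close> is a
  weight for all \<open>n\<close> exactly if \<open>i \<notin> J\<close>.

  Hull. The convex hull of the weights is the least convex \<open>W\<^sub>J\<close>-invariant set that contains \<open>\<Lambda>\<close> and the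
  rays \<open>\<Lambda> - n \<alpha>\<^sub>i\<close> with \<open>i \<notin> J\<close>, hence depends only on \<open>\<Lambda>\<close> and \<open>J\<close>: a weight may be moved to a
  \<open>J\<close>-dominant one, which is reached from \<open>\<Lambda> - \<Sum>\<^sub>i\<^sub>\<notin>\<^sub>J c\<^sub>i \<alpha>\<^sub>i\<close> by subtracting one \<open>\<alpha>\<^sub>j\<close>, \<open>j \<in> J\<close>, at a time,
  always staying between a point and its mirror image. Conversely the hull determines \<open>J\<close> because the
  ray in direction \<open>- \<alpha>\<^sub>i\<close> is a face. The parabolic Verma module \<open>M(\<Lambda>, J)\<close> surjects onto \<open>V\<close>, whence
  it is a highest weight module with integrability \<open>J\<close>.

  Stabilizer. If \<open>w\<close> stabilizes the character, multiply it by an element of \<open>W\<^sub>J\<close> to make it shortest in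
  its coset; then \<open>w \<alpha>\<^sub>j\<close> is positive for \<open>j \<in> J\<close>. For \<open>i \<notin> J\<close> the ray of weights \<open>\<Lambda> - n \<alpha>\<^sub>i\<close> is mapped
  to weights, which lie below \<open>\<Lambda>\<close>, so \<open>w \<alpha>\<^sub>i\<close> is positive too, and \<open>w = 1\<close>.
\<close>

section \<open>Linear functionals\<close>

interpretation fscale: vector_space "fscale :: complex \<Rightarrow> ('a \<Rightarrow> complex) \<Rightarrow> 'a \<Rightarrow> complex"
  by standard (auto simp: fscale_def fun_eq_iff algebra_simps)

lemma fscale_apply [simp]: "fscale c f x = c * f x"
  by (simp add: fscale_def)

lemma dual_iff:
  assumes "vector_space s"
  shows "\<mu> \<in> dual s \<longleftrightarrow> (\<forall>x y. \<mu> (x + y) = \<mu> x + \<mu> y) \<and> (\<forall>c x. \<mu> (s c x) = c * \<mu> x)"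
proof -
  have "vector_space ((*) :: complex \<Rightarrow> complex \<Rightarrow> complex)"
    by standard (auto simp: algebra_simps)
  with assms show ?thesis
    by (auto simp: dual_def module_hom_iff_linear[symmetric] module_hom_iff module_iff_vector_space)
qed

lemma dual_diff:
  assumes "vector_space s" "\<mu> \<in> dual s" "\<nu> \<in> dual s"
  shows "\<mu> - \<nu> \<in> dual s"
  using assms by (auto simp: dual_iff algebra_simps)

lemma dual_fscale:
  assumes "vector_space s" "\<mu> \<in> dual s"
  shows "fscale c \<mu> \<in> dual s"
  using assms by (auto simp: dual_iff algebra_simps)

text \<open>Induction on \<open>S\<close>. If \<open>f\<close> vanishes on the common kernel of
  \<open>S\<close>, then \<open>f\<close> may be dropped. Otherwise some \<open>z\<close> is killed
  by \<open>S\<close> but not by \<open>f\<close>, and subtracting a suitable multiple of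
  \<open>f\<close> from \<open>g\<close> reduces to \<open>S\<close>.\<close>

lemma functional_in_span:
  assumes s: "vector_space s" and "finite S" "S \<subseteq> dual s" "g \<in> dual s"
    and "\<And>x. (\<forall>f\<in>S. f x = 0) \<Longrightarrow> g x = 0"
  shows "g \<in> fscale.span S"
  using assms(2-)
proof (induction S arbitrary: g rule: finite_induct)
  case empty
  then have "g = 0" by (auto simp: fun_eq_iff)
  then show "g \<in> fscale.span {}" by simp
next
  case (insert f S)
  show "g \<in> fscale.span (insert f S)"
  proof (cases "\<forall>x. (\<forall>f\<in>S. f x = 0) \<longrightarrow> f x = 0")
    case True
    then have "g \<in> fscale.span S"
      using insert by (intro insert.IH) auto
    then show ?thesis
      using fscale.span_mono[of S "insert f S"] by blast
  next
    case False
    then obtain z where z: "\<forall>f\<in>S. f z = 0" "f z \<noteq> 0" by blast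
    define c where "c = g z / f z"
    have lin: "k \<in> dual s \<Longrightarrow> k (y + s a z) = k y + a * k z" for k a y
      using s by (simp add: dual_iff)
    have "g - fscale c f \<in> fscale.span S"
    proof (rule insert.IH)
      show "S \<subseteq> dual s" "g - fscale c f \<in> dual s"
        using insert.prems s by (auto intro!: dual_diff dual_fscale)
      fix y assume y: "\<forall>f\<in>S. f y = 0"
      \<comment> \<open>Moving \<open>y\<close> by this multiple of \<open>z\<close> also kills
        \<open>f\<close>, so \<open>g\<close> vanishes at the new point.\<close>
      define a where "a = - f y / f z"
      have "g (y + s a z) = 0"
      proof (rule insert.prems(3), rule ballI)
        fix k assume k: "k \<in> insert f S"
        then have "k (y + s a z) = k y + a * k z"
          using insert.prems(1) by (intro lin) blast
        moreover have "k = f \<or> k y = 0 \<and> k z = 0" using y z k by blast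
        ultimately show "k (y + s a z) = 0"
          using z by (auto simp: a_def)
      qed
      then have "g y + a * g z = 0"
        using lin[OF insert.prems(2)] by simp
      then show "(g - fscale c f) y = 0"
        by (simp add: a_def c_def mult.commute)
    qed
    then have "g - fscale c f \<in> fscale.span (insert f S)"
      using fscale.span_mono[of S "insert f S"] by blast
    moreover have "fscale c f \<in> fscale.span (insert f S)"
      by (intro fscale.span_scale fscale.span_base) simp
    ultimately have "(g - fscale c f) + fscale c f \<in> fscale.span (insert f S)"
      by (rule fscale.span_add)
    then show ?thesis by simp
  qed
qed

text \<open>By independence \<open>f\<close> is outside the span of the other functionals, so
  \<open>functional_in_span\<close> yields a vector killed by all of them but not by
  \<open>f\<close>; it remains to rescale.\<close>

lemma dual_basis_exists:
  assumes s: "vector_space s" and "finite S" "S \<subseteq> dual s" "fscale.independent S" "f \<in> S"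
  shows "\<exists>x. \<forall>g\<in>S. g x = (if g = f then 1 else 0)"
proof -
  have "f \<notin> fscale.span (S - {f})"
    using assms(4,5) fscale.dependent_def by blast
  then obtain z where z: "\<forall>g\<in>S - {f}. g z = 0" "f z \<noteq> 0"
    using functional_in_span[OF s, of "S - {f}" f] assms by blast
  have "g (s (1 / f z) z) = (if g = f then 1 else 0)" if "g \<in> S" for g
  proof -
    have "g (s (1 / f z) z) = (1 / f z) * g z"
      using that assms by (auto simp: dual_iff)
    then show ?thesis using z that by auto
  qed
  then show ?thesis by blast
qed

section \<open>Weights and reflections\<close>

context realization
begin

abbreviation dualh :: "('h \<Rightarrow> complex) set" where "dualh \<equiv> dual sh"

lemma vs_h: "vector_space sh" by unfold_locales

lemmas dual_h_iff = dual_iff[OF vs_h]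

lemma fundamental_coweight_exists: "\<exists>x. \<forall>j\<in>I. \<alpha> j x = (if j = i then 1 else 0)" if "i \<in> I"
proof -
  have "\<exists>x. \<forall>g\<in>\<alpha> ` I. g x = (if g = \<alpha> i then 1 else 0)"
    using that roots_dual roots_indep finite_I by (intro dual_basis_exists[OF vs_h]) auto
  then obtain x where x: "\<forall>g\<in>\<alpha> ` I. g x = (if g = \<alpha> i then 1 else 0)" by blast
  have "\<alpha> j x = (if j = i then 1 else 0)" if "j \<in> I" for j
    using x that inj_on_eq_iff[OF roots_indep(1) that \<open>i \<in> I\<close>] by simp
  then show ?thesis by blast
qed

text \<open>Fundamental coweights: evaluation at \<open>\<omega> i\<close> reads off the coefficient
  of \<open>\<alpha> i\<close> in a combination of simple roots.\<close>

definition \<omega> :: "'i \<Rightarrow> 'h" where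
  "\<omega> i = (SOME x. \<forall>j\<in>I. \<alpha> j x = (if j = i then 1 else 0))"

lemma root_\<omega>: "i \<in> I \<Longrightarrow> j \<in> I \<Longrightarrow> \<alpha> j (\<omega> i) = (if j = i then 1 else 0)"
  using someI_ex[OF fundamental_coweight_exists[of i]] by (auto simp: \<omega>_def)

section \<open>Real combinations of simple roots\<close>

definition comb :: "('i \<Rightarrow> real) \<Rightarrow> 'h \<Rightarrow> complex" where
  "comb c = (\<lambda>h. \<Sum>i\<in>I. of_real (c i) * \<alpha> i h)"

lemma comb_add: "comb (\<lambda>i. c i + d i) = comb c + comb d"
  by (simp add: comb_def fun_eq_iff sum.distrib algebra_simps)

lemma comb_diff: "comb (\<lambda>i. c i - d i) = comb c - comb d"
  by (simp add: comb_def fun_eq_iff sum_subtractf algebra_simps)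

lemma comb_scaleR: "comb (\<lambda>i. r * c i) = r *\<^sub>R comb c"
  by (simp add: comb_def fun_eq_iff scaleR_fun_def scaleR_conv_of_real sum_distrib_left mult.assoc)

lemma comb_0 [simp]: "comb (\<lambda>i. 0) = 0"
  by (simp add: comb_def fun_eq_iff)

lemma comb_cong: "(\<And>i. i \<in> I \<Longrightarrow> c i = d i) \<Longrightarrow> comb c = comb d"
  by (simp add: comb_def)

lemma comb_single: "i \<in> I \<Longrightarrow> comb (\<lambda>k. if k = i then r else 0) = fscale (of_real r) (\<alpha> i)"
  using finite_I by (simp add: comb_def fun_eq_iff if_distrib[of of_real] if_distrib[of "\<lambda>x. x * _"] cong: if_cong)

lemma comb_\<omega>: "i \<in> I \<Longrightarrow> comb c (\<omega> i) = of_real (c i)"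
  using finite_I by (simp add: comb_def root_\<omega> if_distrib cong: if_cong)

lemma comb_inject: "comb c = comb d \<Longrightarrow> i \<in> I \<Longrightarrow> c i = d i"
  using comb_\<omega>[of i c] comb_\<omega>[of i d] by simp

lemma comb_coroot: "i \<in> I \<Longrightarrow> comb c (\<alpha>v i) = of_real (\<Sum>j\<in>I. c j * A i j)"
  by (simp add: comb_def pairing)

lemma comb_dual: "comb c \<in> dualh"
  using roots_dual by (auto simp: comb_def dual_h_iff sum.distrib algebra_simps sum_distrib_left)

lemma root_coroot_self [simp]: "i \<in> I \<Longrightarrow> \<alpha> i (\<alpha>v i) = 2"
  by (simp add: pairing diag)

section \<open>Reflections and words of reflections\<close>

definition rfl :: "'i \<Rightarrow> ('h \<Rightarrow> complex) \<Rightarrow> 'h \<Rightarrow> complex" where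
  "rfl i \<mu> = \<mu> - fscale (\<mu> (\<alpha>v i)) (\<alpha> i)"

lemma rfl_apply: "rfl i \<mu> h = \<mu> h - \<mu> (\<alpha>v i) * \<alpha> i h"
  by (simp add: rfl_def)

lemma rfl_rfl [simp]: "i \<in> I \<Longrightarrow> rfl i (rfl i \<mu>) = \<mu>"
  by (simp add: fun_eq_iff rfl_apply algebra_simps)

lemma rfl_root: "i \<in> I \<Longrightarrow> rfl i (\<alpha> i) = - \<alpha> i"
  by (simp add: fun_eq_iff rfl_apply)

lemma rfl_add: "rfl i (\<mu> + \<nu>) = rfl i \<mu> + rfl i \<nu>"
  by (simp add: fun_eq_iff rfl_apply algebra_simps)

lemma rfl_fscale: "rfl i (fscale c \<mu>) = fscale c (rfl i \<mu>)"
  by (simp add: fun_eq_iff rfl_apply algebra_simps)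

lemma rfl_dual: "i \<in> I \<Longrightarrow> \<mu> \<in> dualh \<Longrightarrow> rfl i \<mu> \<in> dualh"
  unfolding rfl_def using roots_dual by (intro dual_diff[OF vs_h] dual_fscale[OF vs_h])

lemma linear_rfl: "linear (rfl i)"
  by (rule linearI) (simp_all add: fun_eq_iff rfl_apply algebra_simps scaleR_fun_def scaleR_conv_of_real)

text \<open>Weyl group elements are handled as words, the last letter acting first. The action is on
  all functions; restriction to the dual enters only in the comparison with
  \<open>weyl_group\<close>.\<close>

abbreviation wact :: "'i list \<Rightarrow> ('h \<Rightarrow> complex) \<Rightarrow> 'h \<Rightarrow> complex" where
  "wact \<equiv> foldr rfl"

lemma wact_add: "wact w (\<mu> + \<nu>) = wact w \<mu> + wact w \<nu>"
  by (induction w) (simp_all only: foldr.simps o_apply id_apply rfl_add)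

lemma wact_fscale: "wact w (fscale c \<mu>) = fscale c (wact w \<mu>)"
  by (induction w) (simp_all only: foldr.simps o_apply id_apply rfl_fscale)

lemma wact_minus: "wact w (- \<mu>) = - wact w \<mu>"
  using wact_fscale[of w "-1" \<mu>] by (simp add: fscale_def fun_Compl_def)

lemma wact_diff: "wact w (\<mu> - \<nu>) = wact w \<mu> - wact w \<nu>"
  using wact_add[of w \<mu> "- \<nu>"] by (simp add: wact_minus)

lemma wact_rev: "w \<in> lists I \<Longrightarrow> wact (rev w) (wact w \<mu>) = \<mu>"
  by (induction w arbitrary: \<mu>) simp_all

lemma wact_rev': "w \<in> lists I \<Longrightarrow> wact w (wact (rev w) \<mu>) = \<mu>"
  using wact_rev[of "rev w"] by (simp add: in_lists_conv_set)

lemma wact_dual: "w \<in> lists I \<Longrightarrow> \<mu> \<in> dualh \<Longrightarrow> wact w \<mu> \<in> dualh"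
  by (induction w) (auto simp: rfl_dual)

lemma wact_bij: "w \<in> lists I \<Longrightarrow> bij_betw (wact w) dualh dualh"
  by (rule bij_betw_byWitness[where f' = "wact (rev w)"])
    (auto simp: wact_rev wact_rev' wact_dual in_lists_conv_set)

section \<open>Positivity of real roots\<close>

text \<open>The coefficients may be real because only their signs matter.\<close>

definition Qpos :: "('h \<Rightarrow> complex) set" where
  "Qpos = {comb c | c. \<forall>i\<in>I. 0 \<le> c i}"

lemma root_Qpos: "i \<in> I \<Longrightarrow> \<alpha> i \<in> Qpos"
  unfolding Qpos_def using comb_single[of i 1] by (auto intro!: exI[of _ "\<lambda>k. if k = i then 1 else 0"])

lemma Qpos_combination:
  assumes "\<mu> \<in> Qpos" "\<nu> \<in> Qpos" "0 \<le> a" "0 \<le> b"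
  shows "fscale (of_real a) \<mu> + fscale (of_real b) \<nu> \<in> Qpos"
proof -
  obtain c d where c: "\<mu> = comb c" "\<forall>i\<in>I. 0 \<le> c i" and d: "\<nu> = comb d" "\<forall>i\<in>I. 0 \<le> d i"
    using assms by (auto simp: Qpos_def)
  have "fscale (of_real a) \<mu> + fscale (of_real b) \<nu> = comb (\<lambda>i. a * c i + b * d i)"
    by (simp add: c d comb_add comb_scaleR fun_eq_iff scaleR_fun_def scaleR_conv_of_real)
  then show ?thesis using c d assms by (auto simp: Qpos_def intro!: exI[of _ "\<lambda>i. a * c i + b * d i"])
qed

lemma Qpos_antisym: "\<mu> \<in> Qpos \<Longrightarrow> - \<mu> \<in> Qpos \<Longrightarrow> \<mu> = 0"
proof -
  assume "\<mu> \<in> Qpos" "- \<mu> \<in> Qpos"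
  then obtain c d where c: "\<mu> = comb c" "\<forall>i\<in>I. 0 \<le> c i" and d: "- \<mu> = comb d" "\<forall>i\<in>I. 0 \<le> d i"
    by (auto simp: Qpos_def)
  have "comb (\<lambda>i. c i + d i) = comb (\<lambda>i. 0)"
    by (simp add: comb_add flip: c d)
  then have "c i = 0" if "i \<in> I" for i
    using comb_inject[of "\<lambda>i. c i + d i" "\<lambda>i. 0" i] that c d by (auto simp: add_nonneg_eq_0_iff)
  then show "\<mu> = 0" using c comb_cong[of c "\<lambda>i. 0"] by simp
qed

section \<open>Length in the Weyl group\<close>

definition wlen :: "(('h \<Rightarrow> complex) \<Rightarrow> 'h \<Rightarrow> complex) \<Rightarrow> nat" where
  "wlen f = (LEAST n. \<exists>w\<in>lists I. length w = n \<and> wact w = f)"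

lemma wlen_le: "w \<in> lists I \<Longrightarrow> wlen (wact w) \<le> length w"
  unfolding wlen_def by (rule Least_le) auto

lemma wlen_reduced:
  assumes "w \<in> lists I"
  obtains v where "v \<in> lists I" "length v = wlen (wact w)" "wact v = wact w"
proof -
  have "\<exists>v\<in>lists I. length v = wlen (wact w) \<and> wact v = wact w"
    unfolding wlen_def by (rule LeastI) (use assms in auto)
  with that show thesis by blast
qed

text \<open>The words that alternate between the two letters and end in \<open>t\<close>. They grow
  on the left, so that a longer word acts as a shorter one followed by one more reflection.\<close>

fun alternating :: "'i \<Rightarrow> 'i \<Rightarrow> nat \<Rightarrow> 'i list" where
  "alternating s t 0 = []"
| "alternating s t (Suc n) = (if even n then t else s) # alternating s t n"

lemma length_alternating [simp]: "length (alternating s t n) = n"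
  by (induction n) auto

lemma alternating_lists [simp]: "alternating s t n \<in> lists {s, t}"
  by (induction n) auto

lemma alternating_append: "m \<le> n \<Longrightarrow> \<exists>p \<in> lists {s, t}. alternating s t n = p @ alternating s t m"
  by (induction n rule: dec_induct) (auto intro: bexI[of _ "_ # _"])

text \<open>A word in two letters without equal neighbours alternates, so its length and last letter
  determine it. The last two alternatives are those in which \<open>dihedral_positivity\<close> can
  cancel letters.\<close>

lemma alternating_cases:
  assumes "d \<in> lists {s, t}"
  shows "d = alternating s t (length d) \<or> (\<exists>p. d = p @ [s]) \<or> (\<exists>p r q. d = p @ [r, r] @ q)"
  using assms
proof (induction d)
  case (Cons x d)
  then consider "d = alternating s t (length d)" | p where "d = p @ [s]"
    | p r q where "d = p @ [r, r] @ q" by auto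
  then show ?case
  proof cases
    case 1
    show ?thesis
    proof (cases "length d")
      case 0
      then have "x # d = alternating s t (length (x # d)) \<or> x # d = [] @ [s]"
        using Cons.hyps by auto
      then show ?thesis by blast
    next
      case (Suc m)
      have "d = alternating s t (Suc m)"
        using 1 unfolding Suc .
      then obtain r q where d: "d = r # q" "r = (if even m then t else s)"
        by simp
      show ?thesis
      proof (cases "x = r")
        case True
        then have "x # d = [] @ [r, r] @ q" using d by simp
        then show ?thesis by blast
      next
        case False
        then have "x = (if even (length d) then t else s)"
          using d(2) Suc Cons.hyps by (auto split: if_splits)
        then have "x # d = alternating s t (length (x # d))"
          by (simp add: 1[symmetric])
        then show ?thesis by blast
      qed
    qed
  next
    case 2
    then have "x # d = (x # p) @ [s]" by simp
    then show ?thesis by blast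
  next
    case 3
    then have "x # d = (x # p) @ [r, r] @ q" by simp
    then show ?thesis by blast
  qed
qed simp


section \<open>Rank two: the subgroup generated by two simple reflections\<close>

context
  fixes s t assumes st: "s \<in> I" "t \<in> I" "s \<noteq> t"
begin

definition comb2 :: "int \<Rightarrow> int \<Rightarrow> 'h \<Rightarrow> complex" where
  "comb2 x y = fscale (of_int x) (\<alpha> s) + fscale (of_int y) (\<alpha> t)"

lemma rfl_comb2:
  "rfl s (comb2 x y) = comb2 (- (A s t * y) - x) y"
  "rfl t (comb2 x y) = comb2 x (- (A t s * x) - y)"
  using st by (simp_all add: comb2_def fun_eq_iff rfl_apply pairing diag algebra_simps)

text \<open>The final inequality says that the root pairs nonnegatively with the coroot of the
  reflection applied last (of \<open>s\<close> for the empty word). Together with the bound on the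
  product it implies that the next reflection does not decrease the coefficient it changes, and the
  inequality persists.\<close>

lemma alternating_root_large:
  assumes "A s t * A t s \<ge> 4"
  shows "\<exists>x y. wact (alternating s t n) (\<alpha> s) = comb2 x y \<and> 0 \<le> x \<and> 0 \<le> y \<and>
     (if even n then - A s t * y \<le> 2 * x else - A t s * x \<le> 2 * y)"
proof (induction n)
  case 0
  show ?case
    by (rule exI[where x = 1], rule exI[where x = 0]) (simp add: comb2_def fun_eq_iff)
next
  case (Suc n)
  define a where "a = - A s t"
  define b where "b = - A t s"
  have ab: "0 \<le> a" "0 \<le> b" "4 \<le> a * b"
    using off_diag[OF st] off_diag[OF st(2,1) st(3)[symmetric]] assms by (auto simp: a_def b_def)
  from Suc obtain x y where IH: "wact (alternating s t n) (\<alpha> s) = comb2 x y" "0 \<le> x" "0 \<le> y"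
    "if even n then a * y \<le> 2 * x else b * x \<le> 2 * y"
    unfolding a_def b_def by blast
  show ?case
  proof (cases "even n")
    case True
    then have "4 * y \<le> 2 * (b * x)"
      using mult_right_mono[OF ab(3) IH(3)] mult_left_mono[of "a * y" "2 * x" b] IH(4) ab
      by (simp add: algebra_simps)
    moreover have "wact (alternating s t (Suc n)) (\<alpha> s) = comb2 x (b * x - y)"
      using True IH(1) by (simp add: rfl_comb2 b_def)
    ultimately show ?thesis
      using True IH by - (rule exI[where x = x], rule exI[where x = "b * x - y"], auto simp flip: b_def)
  next
    case False
    then have "4 * x \<le> 2 * (a * y)"
      using mult_right_mono[OF ab(3) IH(2)] mult_left_mono[of "b * x" "2 * y" a] IH(4) ab
      by (simp add: algebra_simps)
    moreover have "wact (alternating s t (Suc n)) (\<alpha> s) = comb2 (a * y - x) y"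
      using False IH(1) by (simp add: rfl_comb2 a_def)
    ultimately show ?thesis
      using False IH by - (rule exI[where x = "a * y - x"], rule exI[where x = y], auto simp flip: a_def)
  qed
qed

text \<open>These are the finite types A1 x A1, A2, B2 and G2. The negated entries are nonnegative
  and vanish together, so when they are positive each is bounded by the product.\<close>

lemma cartan_product_small:
  assumes "\<not> A s t * A t s \<ge> 4"
  shows "(A s t, A t s) \<in> {(0, 0), (-1, -1), (-1, -2), (-2, -1), (-1, -3), (-3, -1)}"
proof -
  define a where "a = - A s t"
  define b where "b = - A t s"
  have ab: "0 \<le> a" "0 \<le> b" "a * b < 4" "a = 0 \<longleftrightarrow> b = 0"
    using off_diag[OF st] off_diag[OF st(2,1) st(3)[symmetric]] assms
      iffI[OF zero_sym[OF st(1,2)] zero_sym[OF st(2,1)]]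
    by (auto simp: a_def b_def)
  have "a < 4"
  proof (rule ccontr)
    assume "\<not> a < 4"
    moreover from this have "1 \<le> b" using ab(2,4) by (cases "b = 0") auto
    ultimately show False using ab(3) mult_mono[of 4 a 1 b] by linarith
  qed
  have "b < 4"
  proof (rule ccontr)
    assume "\<not> b < 4"
    moreover from this have "1 \<le> a" using ab(1,4) by (cases "a = 0") auto
    ultimately show False using ab(3) mult_mono[of 1 a 4 b] by linarith
  qed
  have "a = 0 \<or> a = 1 \<or> a = 2 \<or> a = 3" "b = 0 \<or> b = 1 \<or> b = 2 \<or> b = 3"
    using \<open>a < 4\<close> \<open>b < 4\<close> ab(1,2) by arith+
  then have "(a, b) \<in> {(0, 0), (1, 1), (1, 2), (2, 1), (1, 3), (3, 1)}"
    using ab(3,4) by auto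
  moreover have "A s t = - a" "A t s = - b" by (simp_all add: a_def b_def)
  ultimately show ?thesis by auto
qed


end

context
  fixes s t assumes st: "s \<in> I" "t \<in> I" "s \<noteq> t"
begin

text \<open>In the proof \<open>m\<close> is the order 2, 3, 4 or 6 of the product of the two
  reflections. The last clause is a form of the braid relation: appending \<open>s\<close> to the
  alternating word of length \<open>m\<close> gives the element of the one of length
  \<open>m - 1\<close>.\<close>

lemma alternating_root_small:
  assumes "\<not> A s t * A t s \<ge> 4"
  shows "\<exists>m>0. (\<forall>n<m. \<exists>x\<ge>0. \<exists>y\<ge>0. wact (alternating s t n) (\<alpha> s) = comb2 s t x y) \<and>
     (\<forall>\<mu>. wact (alternating s t m) (rfl s \<mu>) = wact (alternating s t (m - 1)) \<mu>)"
proof -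
  have base: "\<alpha> s = comb2 s t 1 0" using comb2_def[OF st] by (simp add: fun_eq_iff)
  \<comment> \<open>Both reflections move a weight only by multiples of the two roots, so the braid
    relation at an arbitrary \<open>\<mu>\<close> becomes arithmetic with two coefficients.\<close>
  define mv where "mv \<mu> x y = \<mu> - fscale x (\<alpha> s) - fscale y (\<alpha> t)" for \<mu> x y
  have mv: "rfl s (mv \<mu> x y) = mv \<mu> (\<mu> (\<alpha>v s) - x - of_int (A s t) * y) y"
    "rfl t (mv \<mu> x y) = mv \<mu> x (\<mu> (\<alpha>v t) - y - of_int (A t s) * x)" for \<mu> x y
    using st by (simp_all add: mv_def fun_eq_iff rfl_apply pairing diag algebra_simps)
  have mv0: "mv \<mu> 0 0 = \<mu>" for \<mu> by (simp add: mv_def fun_eq_iff)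
  \<comment> \<open>\<open>X n\<close> and \<open>Y n\<close> are the coefficients of the root after
    \<open>n\<close> reflections. Each type supplies them as explicit lists of length
    \<open>m\<close>.\<close>
  have main: ?thesis
    if m: "0 < m" and p: "\<And>n. n < m \<Longrightarrow> 0 \<le> X n \<and> 0 \<le> Y n \<and> wact (alternating s t n) (comb2 s t 1 0) = comb2 s t (X n) (Y n)"
      and b: "\<And>\<mu>. wact (alternating s t m) (rfl s (mv \<mu> 0 0)) = wact (alternating s t (m - 1)) (mv \<mu> 0 0)"
    for m X Y
  proof (intro exI[of _ m] conjI allI impI)
    fix n assume "n < m"
    from p[OF this] show "\<exists>x\<ge>0. \<exists>y\<ge>0. wact (alternating s t n) (\<alpha> s) = comb2 s t x y"
      unfolding base by blast
  next
    fix \<mu> show "wact (alternating s t m) (rfl s \<mu>) = wact (alternating s t (m - 1)) \<mu>"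
      using b[of \<mu>] unfolding mv0 .
  qed (rule m)
  consider "A s t = 0" "A t s = 0" | "A s t = -1" "A t s = -1" | "A s t = -1" "A t s = -2"
    | "A s t = -2" "A t s = -1" | "A s t = -1" "A t s = -3" | "A s t = -3" "A t s = -1"
    using cartan_product_small[OF st assms] by auto
  then show ?thesis
  proof cases
    case 1
    show ?thesis
      by (rule main[of 2 "\<lambda>n. [1,1] ! n" "\<lambda>n. [0,0] ! n"])
        (auto simp: less_Suc_eq numeral_2_eq_2 rfl_comb2[OF st] mv 1)
  next
    case 2
    show ?thesis
      by (rule main[of 3 "\<lambda>n. [1,1,0] ! n" "\<lambda>n. [0,1,1] ! n"])
        (auto simp: less_Suc_eq numeral_3_eq_3 rfl_comb2[OF st] mv 2)
  next
    case 3
    show ?thesis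
      by (rule main[of "Suc 3" "\<lambda>n. [1,1,1,1] ! n" "\<lambda>n. [0,2,2,0] ! n"])
        (auto simp: less_Suc_eq numeral_3_eq_3 rfl_comb2[OF st] mv 3 algebra_simps)
  next
    case 4
    show ?thesis
      by (rule main[of "Suc 3" "\<lambda>n. [1,1,1,1] ! n" "\<lambda>n. [0,1,1,0] ! n"])
        (auto simp: less_Suc_eq numeral_3_eq_3 rfl_comb2[OF st] mv 4 algebra_simps)
  next
    case 5
    show ?thesis
      by (rule main[of "Suc (Suc (Suc 3))" "\<lambda>n. [1,1,2,2,1,1] ! n" "\<lambda>n. [0,3,3,3,3,0] ! n"])
        (auto simp: less_Suc_eq numeral_3_eq_3 rfl_comb2[OF st] mv 5 algebra_simps)
  next
    case 6
    show ?thesis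
      by (rule main[of "Suc (Suc (Suc 3))" "\<lambda>n. [1,1,2,2,1,1] ! n" "\<lambda>n. [0,1,1,1,1,0] ! n"])
        (auto simp: less_Suc_eq numeral_3_eq_3 rfl_comb2[OF st] mv 6 algebra_simps)
  qed
qed

text \<open>Equal neighbours cancel in \<open>d\<close>, and a final \<open>s\<close> cancels in
  \<open>d @ [s]\<close>. An alternating word keeps the root positive in the infinite case and below
  length \<open>m\<close> in the finite case; from length \<open>m\<close> on, the braid relation
  shortens \<open>d @ [s]\<close>.\<close>

lemma dihedral_positivity:
  assumes "d \<in> lists {s, t}"
  shows "(\<exists>x\<ge>0. \<exists>y\<ge>0. wact d (\<alpha> s) = comb2 s t x y) \<or>
     (\<exists>d'\<in>lists {s, t}. length d' < length d \<and> (wact d' = wact d \<or> wact d' = wact (d @ [s])))"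
proof -
  consider "d = alternating s t (length d)" | p where "d = p @ [s]" | p r q where "d = p @ [r, r] @ q"
    using alternating_cases[OF assms] by blast
  then show ?thesis
  proof cases
    case 1
    show ?thesis
    proof (cases "A s t * A t s \<ge> 4")
      case True
      then show ?thesis using alternating_root_large[OF st True, of "length d"] 1 by auto
    next
      case False
      then obtain m where m: "0 < m" "\<And>n. n < m \<Longrightarrow> \<exists>x\<ge>0. \<exists>y\<ge>0. wact (alternating s t n) (\<alpha> s) = comb2 s t x y"
        "\<And>\<mu>. wact (alternating s t m) (rfl s \<mu>) = wact (alternating s t (m - 1)) \<mu>"
        using alternating_root_small[OF False] by blast
      show ?thesis
      proof (cases "length d < m")
        case True
        then show ?thesis using m(2)[OF True] 1 by auto
      next
        case False
        then obtain p where p: "p \<in> lists {s, t}" "d = p @ alternating s t m"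
          using alternating_append[of m "length d" s t] 1 by (metis linorder_not_le)
        have "p @ alternating s t (m - 1) \<in> lists {s, t}"
          using p(1) alternating_lists by (metis append_in_lists_conv)
        moreover have "wact (d @ [s]) = wact (p @ alternating s t (m - 1))"
          by (rule ext) (simp add: p(2) m(3) del: One_nat_def)
        moreover have "length (p @ alternating s t (m - 1)) < length d"
          using m(1) p(2) by simp
        ultimately show ?thesis by metis
      qed
    qed
  next
    case 2
    then have "wact p = wact (d @ [s])"
      using st by (intro ext) simp
    moreover have "p \<in> lists {s, t}" "length p < length d"
      using 2 assms by auto
    ultimately show ?thesis by blast
  next
    case 3
    then have "r \<in> I" using assms st by auto
    then have "wact (p @ q) = wact d"
      using 3 by (intro ext) simp
    moreover have "p @ q \<in> lists {s, t}" "length (p @ q) < length d"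
      using 3 assms by auto
    ultimately show ?thesis by blast
  qed
qed

end

lemma Qpos_comb2:
  assumes "s \<in> I" "t \<in> I" "s \<noteq> t" "0 \<le> x" "0 \<le> y" "wact v (\<alpha> s) \<in> Qpos" "wact v (\<alpha> t) \<in> Qpos"
  shows "wact v (comb2 s t x y) \<in> Qpos"
  using Qpos_combination[OF assms(6,7), of "of_int x" "of_int y"] assms(4,5)
  by (simp add: comb2_def[OF assms(1-3)] wact_add wact_fscale)

text \<open>
  As in Deodhar's argument, \<open>w\<close> is factored through a dihedral parabolic subgroup: the left factor
  \<open>v\<close> of a reduced decomposition is chosen shortest, so that the induction hypothesis applies to it.
\<close>

theorem root_positive:
  assumes "w \<in> lists I" "s \<in> I" "wlen (wact w) \<le> wlen (wact (w @ [s]))"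
  shows "wact w (\<alpha> s) \<in> Qpos"
  using assms
proof (induction "wlen (wact w)" arbitrary: w s rule: less_induct)
  case less
  obtain u where u: "u \<in> lists I" "length u = wlen (wact w)" "wact u = wact w"
    using wlen_reduced[OF less.prems(1)] by blast
  show "wact w (\<alpha> s) \<in> Qpos"
  proof (cases u rule: rev_cases)
    case Nil
    then have "wact w (\<alpha> s) = \<alpha> s" using u(3) by (simp add: fun_eq_iff)
    then show ?thesis using root_Qpos less.prems(2) by simp
  next
    case (snoc p t)
    have p: "p \<in> lists I" "t \<in> I" using u snoc by auto
    have "t \<noteq> s"
    proof
      assume "t = s"
      then have "wact (w @ [s]) = wact p"
        using snoc p by (intro ext) (simp flip: u(3))
      then show False using wlen_le[OF p(1)] less.prems(3) u(2) snoc by simp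
    qed
    define D where "D = (\<lambda>v. v \<in> lists I \<and> (\<exists>d\<in>lists {s, t}. wact (v @ d) = wact w \<and> length v + length d = wlen (wact w)))"
    have "D p" unfolding D_def using p u snoc by (intro conjI bexI[of _ "[t]"]) auto
    then obtain v where v: "D v" "\<And>v'. D v' \<Longrightarrow> length v \<le> length v'"
      using ex_has_least_nat[of D p length] by blast
    obtain d where d: "d \<in> lists {s, t}" "wact (v @ d) = wact w" "length v + length d = wlen (wact w)"
      and vI: "v \<in> lists I" using v(1) by (auto simp: D_def)
    have "length v < wlen (wact w)" using v(2)[OF \<open>D p\<close>] u(2) snoc by simp
    then have shorter: "wlen (wact v) < wlen (wact w)" using wlen_le[OF vI] by simp
    \<comment> \<open>If \<open>r\<close> shortened \<open>v\<close>, moving it into the dihedral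
      factor would give a reduced decomposition with a shorter left factor.\<close>
    have "wlen (wact v) \<le> wlen (wact (v @ [r]))" if r: "r \<in> {s, t}" for r
    proof (rule ccontr)
      assume lt: "\<not> ?thesis"
      have rI: "r \<in> I" using r p less.prems by auto
      obtain v' where v': "v' \<in> lists I" "length v' = wlen (wact (v @ [r]))" "wact v' = wact (v @ [r])"
        using wlen_reduced[of "v @ [r]"] vI rI by auto
      have eq: "wact (v' @ r # d) = wact w"
      proof
        show "wact (v' @ r # d) \<mu> = wact w \<mu>" for \<mu>
          using v'(3) rI fun_cong[OF d(2), of \<mu>] by simp
      qed
      have len: "length v' < length v" using lt v'(2) wlen_le[OF vI] by simp
      have "v' @ r # d \<in> lists I" using v' d r less.prems(2) p rI by (auto simp: in_lists_conv_set)
      from wlen_le[OF this] have "wlen (wact w) \<le> length v' + length (r # d)" unfolding eq by simp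
      then have "length v' + length (r # d) = wlen (wact w)" using len d(3) by simp
      then have "D v'" using eq v' d r unfolding D_def by (intro conjI bexI[of _ "r # d"]) auto
      then show False using v(2) len by fastforce
    qed
    then have vs: "wact v (\<alpha> s) \<in> Qpos" "wact v (\<alpha> t) \<in> Qpos"
      using less.hyps[OF shorter vI] p less.prems(2) by auto
    \<comment> \<open>A shorter \<open>d'\<close> would give a word for \<open>w\<close> below its
      length, or show that \<open>w @ [s]\<close> is shorter than \<open>w\<close>, against the
      hypothesis.\<close>
    have "\<not> (\<exists>d'\<in>lists {s, t}. length d' < length d \<and> (wact d' = wact d \<or> wact d' = wact (d @ [s])))"
    proof
      assume "\<exists>d'\<in>lists {s, t}. length d' < length d \<and> (wact d' = wact d \<or> wact d' = wact (d @ [s]))"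
      then obtain d' where d': "d' \<in> lists {s, t}" "length d' < length d"
        "wact d' = wact d \<or> wact d' = wact (d @ [s])" by blast
      have "v @ d' \<in> lists I" using vI d'(1) less.prems(2) p by (auto simp: in_lists_conv_set)
      from wlen_le[OF this] have le: "wlen (wact (v @ d')) < wlen (wact w)" using d' d by simp
      from d'(3) show False
      proof
        assume "wact d' = wact d"
        then have "wact (v @ d') = wact w"
          unfolding d(2)[symmetric] by (intro ext) simp
        then show False using le by simp
      next
        assume "wact d' = wact (d @ [s])"
        then have "wact (v @ d') = wact (w @ [s])"
          using fun_cong[OF d(2)] by (intro ext) simp
        then show False using le less.prems(3) by simp
      qed
    qed
    then obtain x y where xy: "0 \<le> x" "0 \<le> y" "wact d (\<alpha> s) = comb2 s t x y"
      using dihedral_positivity[OF less.prems(2) p(2) \<open>t \<noteq> s\<close>[symmetric] d(1)] by blast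
    have "wact w (\<alpha> s) = wact v (comb2 s t x y)"
      using xy(3) fun_cong[OF d(2), of "\<alpha> s"] by simp
    then show ?thesis
      using Qpos_comb2[OF less.prems(2) p(2) \<open>t \<noteq> s\<close>[symmetric] xy(1,2) vs] by simp
  qed
qed

text \<open>If a reduced word of \<open>w\<close> is \<open>p\<close> followed by \<open>s\<close>,
  then \<open>p\<close> sends \<alpha> of \<open>s\<close> to a positive root, so \<open>w\<close>
  sends it to a negative one. Being positive by hypothesis too, the image would be zero.\<close>

corollary word_trivial:
  assumes w: "w \<in> lists I" and pos: "\<And>i. i \<in> I \<Longrightarrow> wact w (\<alpha> i) \<in> Qpos"
  shows "wact w = id"
proof -
  obtain u where u: "u \<in> lists I" "length u = wlen (wact w)" "wact u = wact w"
    using wlen_reduced[OF w] by blast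
  show ?thesis
  proof (cases u rule: rev_cases)
    case Nil
    then show ?thesis using u(3) by (simp add: id_def fun_eq_iff)
  next
    case (snoc p s)
    then have p: "p \<in> lists I" "s \<in> I" using u by auto
    have "wact (p @ [s]) = wact w" using u snoc by simp
    moreover have "wlen (wact p) < wlen (wact w)" using wlen_le[OF p(1)] u snoc by simp
    ultimately have "wact p (\<alpha> s) \<in> Qpos" using root_positive[OF p] by simp
    moreover have *: "wact w (\<alpha> s) = - wact p (\<alpha> s)"
      using u(3) snoc p(2) by (simp add: rfl_root wact_minus flip: u(3))
    ultimately have "wact p (\<alpha> s) = 0"
      using pos[OF p(2)] by (intro Qpos_antisym) auto
    then have "\<alpha> s = wact (rev p) 0" using wact_rev[OF p(1)] by metis
    also have "wact (rev p) 0 = 0" using wact_fscale[of "rev p" 0 0] by (simp add: fscale_def zero_fun_def)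
    finally show ?thesis using root_coroot_self[OF p(2)] by simp
  qed
qed

text \<open>Choose \<open>u\<close> so that \<open>w @ u\<close> is shortest in its coset. No letter
  of \<open>J\<close> shortens it further, and \<open>root_positive\<close> applies.\<close>

lemma minimal_coset_representative:
  assumes w: "w \<in> lists I" and J: "J \<subseteq> I"
  obtains u where "u \<in> lists J" "\<And>j. j \<in> J \<Longrightarrow> wact (w @ u) (\<alpha> j) \<in> Qpos"
proof -
  obtain u where u: "u \<in> lists J" "\<And>u'. u' \<in> lists J \<Longrightarrow> wlen (wact (w @ u)) \<le> wlen (wact (w @ u'))"
    using ex_has_least_nat[of "\<lambda>u. u \<in> lists J" "[]" "\<lambda>u. wlen (wact (w @ u))"] by auto
  show thesis
  proof
    fix j assume j: "j \<in> J"
    show "wact (w @ u) (\<alpha> j) \<in> Qpos"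
    proof (rule root_positive)
      show "w @ u \<in> lists I" "j \<in> I" using w u J j by (auto simp: in_lists_conv_set)
      show "wlen (wact (w @ u)) \<le> wlen (wact ((w @ u) @ [j]))"
        using u(2)[of "u @ [j]"] u(1) j by simp
    qed
  qed (use u in auto)
qed

section \<open>Parabolic subgroups as words\<close>

lemma simple_reflection_eq: "simple_reflection sh \<alpha> \<alpha>v i = restrict (rfl i) dualh"
  by (simp add: simple_reflection_def rfl_def[abs_def])

lemma restrict_wact_Bij: "w \<in> lists I \<Longrightarrow> restrict (wact w) dualh \<in> Bij dualh"
  using wact_bij by (simp add: Bij_def)

lemma BijGroup_mult_wact:
  assumes "v \<in> lists I" "w \<in> lists I"
  shows "restrict (wact v) dualh \<otimes>\<^bsub>BijGroup dualh\<^esub> restrict (wact w) dualh = restrict (wact (v @ w)) dualh"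
  using assms restrict_wact_Bij wact_dual by (simp add: BijGroup_def compose_def fun_eq_iff)

lemma BijGroup_inv_wact:
  assumes "w \<in> lists I"
  shows "inv\<^bsub>BijGroup dualh\<^esub> restrict (wact w) dualh = restrict (wact (rev w)) dualh"
proof (rule group.inv_equality[OF group_BijGroup])
  have rev: "rev w \<in> lists I" using assms by (simp add: in_lists_conv_set)
  have "restrict (wact (rev w @ w)) dualh = (\<lambda>\<mu>\<in>dualh. \<mu>)"
    using wact_rev[OF assms] by (auto simp: fun_eq_iff)
  then show "restrict (wact (rev w)) dualh \<otimes>\<^bsub>BijGroup dualh\<^esub> restrict (wact w) dualh = \<one>\<^bsub>BijGroup dualh\<^esub>"
    unfolding BijGroup_mult_wact[OF rev assms] by (simp add: BijGroup_def)
qed (use assms restrict_wact_Bij in \<open>auto simp: BijGroup_def in_lists_conv_set\<close>)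

text \<open>The inverses that \<open>generate\<close> admits are again words, because simple
  reflections are involutions.\<close>

lemma weyl_group_words:
  assumes "J \<subseteq> I"
  shows "weyl_group sh \<alpha> \<alpha>v J = (\<lambda>w. restrict (wact w) dualh) ` lists J"
proof (intro equalityI subsetI)
  have J: "w \<in> lists J \<Longrightarrow> w \<in> lists I" for w using assms by (auto simp: in_lists_conv_set)
  fix f assume "f \<in> weyl_group sh \<alpha> \<alpha>v J"
  then show "f \<in> (\<lambda>w. restrict (wact w) dualh) ` lists J"
    unfolding weyl_group_def
  proof (induction rule: generate.induct)
    case one
    then show ?case by (intro image_eqI[of _ _ "[]"]) (auto simp: BijGroup_def fun_eq_iff)
  next
    case (incl h)
    then obtain i where "i \<in> J" "h = simple_reflection sh \<alpha> \<alpha>v i" by auto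
    then show ?case by (intro image_eqI[of _ _ "[i]"]) (auto simp: simple_reflection_eq fun_eq_iff)
  next
    case (inv h)
    then obtain i where i: "i \<in> J" "h = simple_reflection sh \<alpha> \<alpha>v i" by auto
    then have "h = restrict (wact [i]) dualh" by (auto simp: simple_reflection_eq fun_eq_iff)
    then have "inv\<^bsub>BijGroup dualh\<^esub> h = restrict (wact [i]) dualh"
      using BijGroup_inv_wact[OF J, of "[i]"] i by simp
    then show ?case using i by (intro image_eqI[of _ _ "[i]"]) auto
  next
    case (eng h1 h2)
    then obtain v w where "v \<in> lists J" "w \<in> lists J" "h1 = restrict (wact v) dualh"
      "h2 = restrict (wact w) dualh" by blast
    then show ?case using BijGroup_mult_wact[OF J J] by (intro image_eqI[of _ _ "v @ w"]) auto
  qed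
next
  have J: "w \<in> lists J \<Longrightarrow> w \<in> lists I" for w using assms by (auto simp: in_lists_conv_set)
  fix f assume "f \<in> (\<lambda>w. restrict (wact w) dualh) ` lists J"
  then obtain w where w: "w \<in> lists J" "f = restrict (wact w) dualh" by auto
  have "restrict (wact w) dualh \<in> weyl_group sh \<alpha> \<alpha>v J"
    using w(1)
  proof (induction w)
    case Nil
    have "\<one>\<^bsub>BijGroup dualh\<^esub> = restrict (wact []) dualh"
      by (auto simp: BijGroup_def fun_eq_iff)
    then show ?case unfolding weyl_group_def by (metis generate.one)
  next
    case (Cons i w)
    have *: "restrict (wact (i # w)) dualh =
      simple_reflection sh \<alpha> \<alpha>v i \<otimes>\<^bsub>BijGroup dualh\<^esub> restrict (wact w) dualh"
      using BijGroup_mult_wact[of "[i]" w] Cons.hyps J assms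
      by (auto simp: simple_reflection_eq restrict_def)
    have "restrict (wact (i # w)) dualh \<in> weyl_group sh \<alpha> \<alpha>v J"
      unfolding * weyl_group_def
      by (rule generate.eng[OF generate.incl Cons.IH[unfolded weyl_group_def]]) (use Cons.hyps in simp)
    then show ?case .
  qed
  then show "f \<in> weyl_group sh \<alpha> \<alpha>v J" using w(2) by simp
qed

text \<open>Each reflection from \<open>J\<close> subtracts a multiple of its root. The multiples
  are complex for general \<open>\<mu>\<close>, so \<open>comb\<close> does not express the
  difference.\<close>

lemma wact_diff_parabolic:
  assumes "J \<subseteq> I" "w \<in> lists J" "\<mu> \<in> dualh"
  shows "\<exists>c. (\<forall>i. i \<notin> J \<longrightarrow> c i = 0) \<and> wact w \<mu> = \<mu> - (\<lambda>h. \<Sum>i\<in>I. c i * \<alpha> i h)"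
  using assms(2)
proof (induction w)
  case Nil
  then show ?case by (intro exI[of _ "\<lambda>_. 0"]) (simp add: fun_eq_iff)
next
  case (Cons j w)
  obtain c where c: "\<forall>i. i \<notin> J \<longrightarrow> c i = 0" "wact w \<mu> = \<mu> - (\<lambda>h. \<Sum>i\<in>I. c i * \<alpha> i h)"
    using Cons.IH by blast
  define p where "p = wact w \<mu> (\<alpha>v j)"
  have j: "j \<in> I" "j \<in> J" using Cons.hyps assms by auto
  have "(\<Sum>i\<in>I. (c i + (if i = j then p else 0)) * \<alpha> i h) = (\<Sum>i\<in>I. c i * \<alpha> i h) + p * \<alpha> j h" for h
    using finite_I j by (simp add: sum.distrib algebra_simps if_distrib[of "\<lambda>x. _ * x"] cong: if_cong)
  then have "wact (j # w) \<mu> = \<mu> - (\<lambda>h. \<Sum>i\<in>I. (c i + (if i = j then p else 0)) * \<alpha> i h)"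
    using c(2) by (simp add: fun_eq_iff rfl_apply p_def)
  then show ?case using c(1) j by (intro exI[of _ "\<lambda>i. c i + (if i = j then p else 0)"]) auto
qed

text \<open>For \<open>j\<close> outside \<open>K\<close>, words in \<open>K\<close> preserve the
  coefficient 1 of \<open>\<alpha> j\<close> in itself, whereas the reflection in \<open>j\<close>
  turns it into -1.\<close>

lemma parabolic_subgroup_inject:
  assumes "J \<subseteq> I" "K \<subseteq> I" "weyl_group sh \<alpha> \<alpha>v J = weyl_group sh \<alpha> \<alpha>v K"
  shows "J = K"
proof -
  have "j \<in> K" if H: "j \<in> J" "J \<subseteq> I" "K \<subseteq> I" "weyl_group sh \<alpha> \<alpha>v J = weyl_group sh \<alpha> \<alpha>v K" for j J K
  proof (rule ccontr)
    assume "j \<notin> K"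
    have "restrict (wact [j]) dualh \<in> weyl_group sh \<alpha> \<alpha>v J"
      unfolding weyl_group_words[OF H(2)] using H(1) by (intro imageI) simp
    then have "restrict (wact [j]) dualh \<in> weyl_group sh \<alpha> \<alpha>v K"
      by (simp only: H(4))
    then obtain w where w: "w \<in> lists K" "restrict (wact [j]) dualh = restrict (wact w) dualh"
      unfolding weyl_group_words[OF H(3)] by blast
    have j: "j \<in> I" "\<alpha> j \<in> dualh" using H roots_dual by auto
    obtain c where c: "\<forall>i. i \<notin> K \<longrightarrow> c i = 0" "wact w (\<alpha> j) = \<alpha> j - (\<lambda>h. \<Sum>i\<in>I. c i * \<alpha> i h)"
      using wact_diff_parabolic[OF H(3) w(1) j(2)] by blast
    have "(\<Sum>i\<in>I. c i * \<alpha> i (\<omega> j)) = c j"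
      using finite_I j by (simp add: root_\<omega> if_distrib cong: if_cong)
    then have "wact w (\<alpha> j) (\<omega> j) = 1"
      using c j \<open>j \<notin> K\<close> by (simp add: root_\<omega>)
    moreover have "wact w (\<alpha> j) = - \<alpha> j"
      using fun_cong[OF w(2), of "\<alpha> j"] j by (simp add: rfl_root)
    ultimately show False using j by (simp add: root_\<omega>)
  qed
  from this[of _ J K] this[of _ K J] assms show ?thesis by blast
qed

end

section \<open>Strings of weight spaces under \<open>sl\<^sub>2\<close>\<close>

text \<open>\<open>U k\<close> models the weight space \<open>k\<close> steps along a root string,
  and \<open>c\<close> the pairing of its base point with the coroot. In this abstract form
  \<open>e\<close> and \<open>f\<close> can be interchanged.\<close>

locale sl2_string = vector_space s for s :: "complex \<Rightarrow> 'v \<Rightarrow> 'v::ab_group_add" +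
  fixes e f :: "'v \<Rightarrow> 'v" and U :: "int \<Rightarrow> 'v set" and c :: complex
  assumes e_add: "e (x + y) = e x + e y" and e_scale: "e (s a x) = s a (e x)"
    and f_add: "f (x + y) = f x + f y" and f_scale: "f (s a x) = s a (f x)"
    and U_subspace: "subspace (U k)"
    and e_U: "x \<in> U k \<Longrightarrow> e x \<in> U (k + 1)" and f_U: "x \<in> U k \<Longrightarrow> f x \<in> U (k - 1)"
    and e_f: "x \<in> U k \<Longrightarrow> e (f x) = f (e x) + s (c + 2 * of_int k) x"
begin

lemma e_pow: "(e ^^ n) (x + y) = (e ^^ n) x + (e ^^ n) y" "(e ^^ n) (s a x) = s a ((e ^^ n) x)"
  by (induction n) (simp_all add: e_add e_scale)

lemma f_pow: "(f ^^ n) (x + y) = (f ^^ n) x + (f ^^ n) y" "(f ^^ n) (s a x) = s a ((f ^^ n) x)"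
  by (induction n) (simp_all add: f_add f_scale)

lemma e_pow_U: "x \<in> U k \<Longrightarrow> (e ^^ n) x \<in> U (k + int n)"
proof (induction n)
  case (Suc n)
  then show ?case using e_U[of "(e ^^ n) x" "k + int n"] by (simp add: algebra_simps)
qed simp

lemma f_pow_U: "x \<in> U k \<Longrightarrow> (f ^^ n) x \<in> U (k - int n)"
proof (induction n)
  case (Suc n)
  then show ?case using f_U[of "(f ^^ n) x" "k - int n"] by (simp add: algebra_simps)
qed simp

lemma e_f_pow:
  assumes "x \<in> U k" "e x = 0"
  shows "e ((f ^^ Suc n) x) = s (of_nat (Suc n) * (c + 2 * of_int k - of_nat n)) ((f ^^ n) x)"
proof (induction n)
  case 0
  have "f 0 = 0" using f_scale[of 0 0] by simp
  then show ?case using e_f[OF assms(1)] assms(2) by simp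
next
  case (Suc n)
  have "e ((f ^^ Suc (Suc n)) x) = f (e ((f ^^ Suc n) x)) + s (c + 2 * of_int (k - int (Suc n))) ((f ^^ Suc n) x)"
    using e_f[OF f_pow_U[OF assms(1), of "Suc n"]] by simp
  also have "\<dots> = s (of_nat (Suc n) * (c + 2 * of_int k - of_nat n) + (c + 2 * of_int (k - int (Suc n)))) ((f ^^ Suc n) x)"
    unfolding Suc f_scale by (simp add: scale_left_distrib)
  also have "of_nat (Suc n) * (c + 2 * of_int k - of_nat n) + (c + 2 * of_int (k - int (Suc n)))
      = of_nat (Suc (Suc n)) * (c + 2 * of_int k - of_nat (Suc n))"
    by (simp add: algebra_simps)
  finally show ?case .
qed

text \<open>Each application of \<open>e\<close> contributes a factor
  \<open>(k + 1) * (d - k)\<close> with \<open>k < d\<close>, which is nonzero.\<close>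

lemma e_pow_f_pow:
  assumes "x \<in> U k" "e x = 0" "c + 2 * of_int k = of_nat d" "a + b \<le> d"
  shows "\<exists>r. r \<noteq> 0 \<and> (e ^^ a) ((f ^^ (a + b)) x) = s r ((f ^^ b) x)"
  using assms(4)
proof (induction a)
  case 0
  then show ?case by (intro exI[of _ 1]) simp
next
  case (Suc a)
  then obtain r where r: "r \<noteq> 0" "(e ^^ a) ((f ^^ (a + b)) x) = s r ((f ^^ b) x)" by auto
  define q :: complex where "q = of_nat (Suc (a + b)) * (of_nat d - of_nat (a + b))"
  have "(e ^^ Suc a) ((f ^^ (Suc a + b)) x) = (e ^^ a) (e ((f ^^ Suc (a + b)) x))"
    by (simp add: funpow_swap1)
  also have "\<dots> = s (q * r) ((f ^^ b) x)"
    unfolding e_f_pow[OF assms(1,2)] assms(3) q_def[symmetric] e_pow(2) r(2) by simp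
  finally have "(e ^^ Suc a) ((f ^^ (Suc a + b)) x) = s (q * r) ((f ^^ b) x)" .
  moreover have "q \<noteq> 0" using Suc.prems unfolding q_def
    by (metis Suc_eq_plus1 Suc_le_lessD add_Suc mult_eq_0_iff of_nat_eq_0_iff of_nat_eq_iff
        less_irrefl right_minus_eq nat.distinct(1))
  ultimately show ?case using r(1) by (intro exI[of _ "q * r"]) simp
qed

text \<open>
  Peeling off highest weight vectors \<open>y\<close> shows that the weight space of weight \<open>m \<ge> 0\<close> is spanned by
  vectors \<open>f\<^sup>N y\<close>, on each of which \<open>e\<^sup>m f\<^sup>m\<close> is a nonzero scalar.
\<close>

lemma e_pow_onto:
  assumes c: "c = of_nat m" and nil: "\<And>x. x \<in> U 0 \<Longrightarrow> \<exists>N. (e ^^ N) x = 0" and x: "x \<in> U 0"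
  shows "\<exists>z\<in>U 0. x = (e ^^ m) ((f ^^ m) z)"
proof -
  have "\<exists>z\<in>U 0. x = (e ^^ m) ((f ^^ m) z)" if "x \<in> U 0" "(e ^^ N) x = 0" for N x
    using that
  proof (induction N arbitrary: x)
    case 0
    have "(e ^^ m) ((f ^^ m) 0) = 0"
      using e_pow(2)[of m 0 0] f_pow(2)[of m 0 0] by simp
    then show ?case using 0 by force
  next
    case (Suc N)
    define y where "y = (e ^^ N) x"
    have y: "y \<in> U (int N)" "e y = 0"
      using e_pow_U[OF Suc.prems(1), of N] Suc.prems(2) by (simp_all add: y_def)
    have d: "c + 2 * of_int (int N) = of_nat (m + 2 * N)" by (simp add: c)
    obtain r where r: "r \<noteq> 0" "(e ^^ N) ((f ^^ N) y) = s r y"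
      using e_pow_f_pow[OF y d, of N 0] by auto
    obtain q where q: "q \<noteq> 0" "(e ^^ m) ((f ^^ (m + N)) y) = s q ((f ^^ N) y)"
      using e_pow_f_pow[OF y d, of m N] by auto
    have fy: "(f ^^ N) y \<in> U 0" using f_pow_U[OF y(1), of N] by simp
    \<comment> \<open>Since \<open>e^N f^N y = r y\<close> and \<open>y = e^N x\<close>, this
      correction makes \<open>e^N\<close> vanish, which lowers the induction parameter.\<close>
    define x' where "x' = x + s (- inverse r) ((f ^^ N) y)"
    have "x' \<in> U 0" unfolding x'_def
      using fy Suc.prems(1) U_subspace by (blast intro: subspace_add subspace_scale)
    moreover have "(e ^^ N) x' = 0"
      unfolding x'_def e_pow r(2) unfolding y_def[symmetric] using r(1) by simp
    ultimately obtain z where z: "z \<in> U 0" "x' = (e ^^ m) ((f ^^ m) z)"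
      using Suc.IH by blast
    define z' where "z' = z + s (inverse r * inverse q) ((f ^^ N) y)"
    have "(e ^^ m) ((f ^^ m) ((f ^^ N) y)) = s q ((f ^^ N) y)"
      using q(2) by (simp add: funpow_add)
    then have "(e ^^ m) ((f ^^ m) z') = x' + s (inverse r) ((f ^^ N) y)"
      unfolding z'_def e_pow f_pow using q(1) z(2) by simp
    then have "x = (e ^^ m) ((f ^^ m) z')" by (simp add: x'_def)
    moreover have "z' \<in> U 0" unfolding z'_def
      using fy z(1) U_subspace by (blast intro: subspace_add subspace_scale)
    ultimately show ?case by blast
  qed
  then show ?thesis using nil[OF x] x by blast
qed

end

section \<open>Modules over a Kac--Moody algebra\<close>

context kac_moody_algebra
begin

abbreviation gen :: "('i, 'h) km_gen \<Rightarrow> 'g" where "gen \<equiv> case_km_gen H E F"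

lemma eval_rel:
  assumes "(s, t) \<in> km_rels I A sh \<alpha> \<alpha>v" "set_lie_term s \<subseteq> km_gens I" "set_lie_term t \<subseteq> km_gens I"
  shows "lie_eval sg br gen s = lie_eval sg br gen t"
  using eval_eq_iff[OF assms(2,3)] lie_cong.rel[OF assms(1)] by blast

lemma gens: "HGen h \<in> km_gens I" "i \<in> I \<Longrightarrow> EGen i \<in> km_gens I" "i \<in> I \<Longrightarrow> FGen i \<in> km_gens I"
  by (auto simp: km_gens_def)

lemma br_h_e: "i \<in> I \<Longrightarrow> br (H h) (E i) = sg (\<alpha> i h) (E i)"
  using eval_rel[OF km_rels.h_e[of i I h]] by (simp add: gens)

lemma br_h_f: "i \<in> I \<Longrightarrow> br (H h) (F i) = sg (- \<alpha> i h) (F i)"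
  using eval_rel[OF km_rels.h_f[of i I h]] by (simp add: gens)

lemma br_e_f: "i \<in> I \<Longrightarrow> j \<in> I \<Longrightarrow> br (E i) (F j) = (if i = j then H (\<alpha>v i) else 0)"
  using eval_rel[OF km_rels.e_f[of i I j]] by (auto simp: gens split: if_splits)

lemma serre_F:
  assumes "i \<in> I" "j \<in> I" "i \<noteq> j"
  shows "(br (F i) ^^ nat (1 - A i j)) (F j) = 0"
proof -
  have sub: "set_lie_term ((LBr (LGen (FGen i)) ^^ n) (LGen (FGen j))) \<subseteq> km_gens I" for n
    using assms by (induction n) (auto simp: gens)
  have ev: "lie_eval sg br gen ((LBr (LGen (FGen i)) ^^ n) (LGen (FGen j))) = (br (F i) ^^ n) (F j)" for n
    by (induction n) auto
  show ?thesis
    using eval_rel[OF km_rels.serre_f[OF assms] sub] unfolding ev by simp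
qed

end

locale km_module =
  kac_moody_algebra I A sh \<alpha> \<alpha>v sg br H E F + V: lie_module sg br sV act
  for I :: "'i set" and A :: "'i \<Rightarrow> 'i \<Rightarrow> int"
    and sh :: "complex \<Rightarrow> 'h \<Rightarrow> 'h::ab_group_add"
    and \<alpha> :: "'i \<Rightarrow> 'h \<Rightarrow> complex" and \<alpha>v :: "'i \<Rightarrow> 'h"
    and sg :: "complex \<Rightarrow> 'g \<Rightarrow> 'g::ab_group_add" and br :: "'g \<Rightarrow> 'g \<Rightarrow> 'g"
    and H :: "'h \<Rightarrow> 'g" and E :: "'i \<Rightarrow> 'g" and F :: "'i \<Rightarrow> 'g"
    and sV :: "complex \<Rightarrow> 'v \<Rightarrow> 'v::ab_group_add" and act :: "'g \<Rightarrow> 'v \<Rightarrow> 'v"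
begin

lemma act_zero [simp]: "act x 0 = 0" "act 0 v = 0"
  using V.act_scale_right[of x 0 0] V.act_scale_left[of 0 0 v] by (simp_all add: scale_zero_left)

lemma act_minus: "act x (- v) = - act x v"
  using V.act_scale_right[of x "-1" v] by simp

lemma act_diff: "act x (v - w) = act x v - act x w"
  using V.act_add_right[of x v "- w"] by (simp add: act_minus)

lemma act_sum: "act x (sum g S) = (\<Sum>s\<in>S. act x (g s))"
  by (induction S rule: infinite_finite_induct) (simp_all add: V.act_add_right)

lemma act_pow_zero [simp]: "(act x ^^ n) 0 = 0"
  by (induction n) simp_all

lemma act_pow_add: "(act x ^^ n) (v + w) = (act x ^^ n) v + (act x ^^ n) w"
  by (induction n) (simp_all add: V.act_add_right)

lemma act_pow_scale: "(act x ^^ n) (sV c v) = sV c ((act x ^^ n) v)"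
  by (induction n) (simp_all add: V.act_scale_right)

lemma act_h_e: "i \<in> I \<Longrightarrow> act (H h) (act (E i) v) = act (E i) (act (H h) v) + sV (\<alpha> i h) (act (E i) v)"
  using V.act_br[of "H h" "E i" v] by (simp add: br_h_e V.act_scale_left algebra_simps)

lemma act_h_f: "i \<in> I \<Longrightarrow> act (H h) (act (F i) v) = act (F i) (act (H h) v) - sV (\<alpha> i h) (act (F i) v)"
  using V.act_br[of "H h" "F i" v] by (simp add: br_h_f V.act_scale_left algebra_simps del: scale_minus_left)

lemma act_e_f: "i \<in> I \<Longrightarrow> j \<in> I \<Longrightarrow>
    act (E i) (act (F j) v) = act (F j) (act (E i) v) + (if i = j then act (H (\<alpha>v i)) v else 0)"
  using V.act_br[of "E i" "F j" v] by (auto simp: br_e_f algebra_simps)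

lemma act_f_commute:
  assumes "i \<in> I" "j \<in> I" "i \<noteq> j" "A i j = 0"
  shows "act (F i) (act (F j) v) = act (F j) (act (F i) v)"
  using V.act_br[of "F i" "F j" v] serre_F[OF assms(1-3)] assms(4) by simp

text \<open>Every element of the Lie algebra is the value of a term in the generators. Stability
  passes to brackets because they act as commutators.\<close>

lemma submoduleI:
  assumes N: "V.subspace N" and h: "\<And>h v. v \<in> N \<Longrightarrow> act (H h) v \<in> N"
    and e: "\<And>i v. i \<in> I \<Longrightarrow> v \<in> N \<Longrightarrow> act (E i) v \<in> N"
    and f: "\<And>i v. i \<in> I \<Longrightarrow> v \<in> N \<Longrightarrow> act (F i) v \<in> N"
  shows "submodule sV act N"
proof -
  have "\<forall>v\<in>N. act (lie_eval sg br gen t) v \<in> N" if "set_lie_term t \<subseteq> km_gens I" for t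
    using that
  proof (induction t)
    case (LGen x)
    then show ?case using h e f by (auto simp: km_gens_def)
  qed (use N in \<open>auto simp: V.act_add_left V.act_scale_left V.act_br V.subspace_0
        intro!: V.subspace_add V.subspace_scale V.subspace_diff\<close>)
  then have "act x v \<in> N" if "v \<in> N" for x v
    using that generated[of x] by blast
  then show ?thesis using N by (simp add: submodule_def)
qed

abbreviation Wt :: "('h \<Rightarrow> complex) \<Rightarrow> 'v set" where "Wt \<equiv> weight_space H sV act"

lemma Wt_iff: "v \<in> Wt \<mu> \<longleftrightarrow> (\<forall>h. act (H h) v = sV (\<mu> h) v)"
  by (simp add: weight_space_def)

lemma subspace_Wt: "V.subspace (Wt \<mu>)"
  by (auto simp: V.subspace_def Wt_iff V.act_add_right V.act_scale_right V.scale_right_distrib mult.commute)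

lemma e_Wt: "i \<in> I \<Longrightarrow> v \<in> Wt \<mu> \<Longrightarrow> act (E i) v \<in> Wt (\<mu> + \<alpha> i)"
  by (simp add: Wt_iff act_h_e V.act_scale_right V.scale_left_distrib)

lemma f_Wt: "i \<in> I \<Longrightarrow> v \<in> Wt \<mu> \<Longrightarrow> act (F i) v \<in> Wt (\<mu> - \<alpha> i)"
  by (simp add: Wt_iff act_h_f V.act_scale_right V.scale_left_diff_distrib)

text \<open>Applying \<open>H h\<close> minus the scalar \<open>\<rho> h\<close> removes the
  component of weight \<open>\<rho>\<close> and rescales the others, by a nonzero factor for
  suitable \<open>h\<close>.\<close>

lemma weight_vectors_independent:
  assumes "finite S" "\<And>\<nu>. \<nu> \<in> S \<Longrightarrow> y \<nu> \<in> Wt \<nu>" "(\<Sum>\<nu>\<in>S. y \<nu>) = 0" "\<nu> \<in> S"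
  shows "y \<nu> = 0"
proof -
  have "\<forall>y. (\<forall>\<nu>\<in>S. y \<nu> \<in> Wt \<nu>) \<longrightarrow> (\<Sum>\<nu>\<in>S. y \<nu>) = 0 \<longrightarrow> (\<forall>\<nu>\<in>S. y \<nu> = 0)"
    using assms(1)
  proof (induction S rule: finite_induct)
    case (insert \<rho> S)
    show ?case
    proof (intro allI impI)
      fix y assume y: "\<forall>\<nu>\<in>insert \<rho> S. y \<nu> \<in> Wt \<nu>" and sum: "(\<Sum>\<nu>\<in>insert \<rho> S. y \<nu>) = 0"
      have sum': "y \<rho> + (\<Sum>\<nu>\<in>S. y \<nu>) = 0" using sum insert by simp
      have z: "\<forall>\<nu>\<in>S. sV (\<nu> h - \<rho> h) (y \<nu>) = 0" for h
      proof -
        have "(\<Sum>\<nu>\<in>S. sV (\<nu> h - \<rho> h) (y \<nu>)) =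
          act (H h) (y \<rho> + (\<Sum>\<nu>\<in>S. y \<nu>)) - sV (\<rho> h) (y \<rho> + (\<Sum>\<nu>\<in>S. y \<nu>))"
          using y by (simp add: V.act_add_right act_sum Wt_iff V.scale_right_distrib V.scale_sum_right
              V.scale_left_diff_distrib sum_subtractf)
        also have "\<dots> = 0" using sum' by simp
        finally have 0: "(\<Sum>\<nu>\<in>S. sV (\<nu> h - \<rho> h) (y \<nu>)) = 0" .
        have "\<forall>\<nu>\<in>S. sV (\<nu> h - \<rho> h) (y \<nu>) \<in> Wt \<nu>"
          using y subspace_Wt by (auto intro: V.subspace_scale)
        with 0 insert.IH[THEN spec, of "\<lambda>\<nu>. sV (\<nu> h - \<rho> h) (y \<nu>)"] show ?thesis by blast
      qed
      have "y \<nu> = 0" if "\<nu> \<in> S" for \<nu>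
      proof -
        have "\<nu> \<noteq> \<rho>" using that insert by auto
        then obtain h where "\<nu> h \<noteq> \<rho> h" by (auto simp: fun_eq_iff)
        then show ?thesis using z[of h] that by auto
      qed
      then show "\<forall>\<nu>\<in>insert \<rho> S. y \<nu> = 0" using sum' by simp
    qed
  qed simp
  then show ?thesis using assms by blast
qed

lemma sl2_string_e:
  assumes "i \<in> I"
  shows "sl2_string sV (act (E i)) (act (F i)) (\<lambda>k. Wt (\<mu> + fscale (of_int k) (\<alpha> i))) (\<mu> (\<alpha>v i))"
proof unfold_locales
  fix k x assume x: "x \<in> Wt (\<mu> + fscale (of_int k) (\<alpha> i))"
  have "\<mu> + fscale (of_int (k + 1)) (\<alpha> i) = \<mu> + fscale (of_int k) (\<alpha> i) + \<alpha> i"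
    "\<mu> + fscale (of_int (k - 1)) (\<alpha> i) = \<mu> + fscale (of_int k) (\<alpha> i) - \<alpha> i"
    by (auto simp: fun_eq_iff algebra_simps)
  then show "act (E i) x \<in> Wt (\<mu> + fscale (of_int (k + 1)) (\<alpha> i))"
    "act (F i) x \<in> Wt (\<mu> + fscale (of_int (k - 1)) (\<alpha> i))"
    using e_Wt[OF assms x] f_Wt[OF assms x] by (simp_all only:)
  show "act (E i) (act (F i) x) = act (F i) (act (E i) x) + sV (\<mu> (\<alpha>v i) + 2 * of_int k) x"
    using x assms by (simp add: act_e_f Wt_iff mult.commute)
qed (simp_all add: V.act_add_right V.act_scale_right subspace_Wt)

text \<open>With \<open>E\<close> and \<open>F\<close> interchanged the pairing changes sign, so
  that \<open>e_pow_onto\<close> also covers weights with negative pairing.\<close>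

lemma sl2_string_f:
  assumes "i \<in> I"
  shows "sl2_string sV (act (F i)) (act (E i)) (\<lambda>k. Wt (\<mu> - fscale (of_int k) (\<alpha> i))) (- \<mu> (\<alpha>v i))"
proof unfold_locales
  fix k x assume x: "x \<in> Wt (\<mu> - fscale (of_int k) (\<alpha> i))"
  have "\<mu> - fscale (of_int (k + 1)) (\<alpha> i) = \<mu> - fscale (of_int k) (\<alpha> i) - \<alpha> i"
    "\<mu> - fscale (of_int (k - 1)) (\<alpha> i) = \<mu> - fscale (of_int k) (\<alpha> i) + \<alpha> i"
    by (auto simp: fun_eq_iff algebra_simps)
  then show "act (F i) x \<in> Wt (\<mu> - fscale (of_int (k + 1)) (\<alpha> i))"
    "act (E i) x \<in> Wt (\<mu> - fscale (of_int (k - 1)) (\<alpha> i))"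
    using e_Wt[OF assms x] f_Wt[OF assms x] by (simp_all only:)
  have "sV (- \<mu> (\<alpha>v i) + 2 * of_int k) x = - sV (\<mu> (\<alpha>v i) - 2 * of_int k) x"
    by (simp flip: V.scale_minus_left)
  then show "act (F i) (act (E i) x) = act (E i) (act (F i) x) + sV (- \<mu> (\<alpha>v i) + 2 * of_int k) x"
    using x assms by (simp add: act_e_f Wt_iff mult.commute)
qed (simp_all add: V.act_add_right V.act_scale_right subspace_Wt)

text \<open>In the Leibniz expansion every summand contains at least \<open>m\<close> brackets on
  \<open>x\<close> or at least \<open>n\<close> actions on \<open>w\<close>. Induction on
  \<open>m + n\<close> replaces the binomial sum.\<close>

lemma leibniz_nilpotent:
  "(br y ^^ m) x = 0 \<Longrightarrow> (act y ^^ n) w = 0 \<Longrightarrow> (act y ^^ (m + n)) (act x w) = 0"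
proof (induction "m + n" arbitrary: m n x w)
  case 0
  then show ?case by simp
next
  case (Suc l)
  show ?case
  proof (cases "m = 0 \<or> n = 0")
    case True
    then show ?thesis using Suc.prems by auto
  next
    case False
    then obtain m' n' where mn: "m = Suc m'" "n = Suc n'" by (metis not0_implies_Suc)
    have "act y (act x w) = act (br y x) w + act x (act y w)"
      using V.act_br[of y x w] by simp
    then have "(act y ^^ (m + n)) (act x w) =
        (act y ^^ (m' + n)) (act (br y x) w) + (act y ^^ (m + n')) (act x (act y w))"
    proof -
      assume *: "act y (act x w) = act (br y x) w + act x (act y w)"
      have "(act y ^^ (m + n)) (act x w) = (act y ^^ (m' + n)) (act y (act x w))"
        by (simp add: mn(1) funpow_swap1)
      moreover have "m' + n = m + n'" using mn by simp
      ultimately show ?thesis by (simp only: * act_pow_add)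
    qed
    moreover have "(act y ^^ (m' + n)) (act (br y x) w) = 0"
      using Suc.prems Suc.hyps(2) mn by (intro Suc.hyps(1)) (simp_all add: funpow_swap1)
    moreover have "(act y ^^ (m + n')) (act x (act y w)) = 0"
      using Suc.prems Suc.hyps(2) mn by (intro Suc.hyps(1)) (simp_all add: funpow_swap1)
    ultimately show ?thesis by simp
  qed
qed

lemma f_ad_nilpotent:
  assumes "i \<in> I" "j \<in> I"
  shows "\<exists>m. (br (F i) ^^ m) (F j) = 0"
proof (cases "i = j")
  case True
  then show ?thesis using br_alternating by (intro exI[of _ 1]) simp
qed (use serre_F[OF assms] in blast)

end

section \<open>Highest weight modules\<close>

locale km_highest_weight_module =
  km_module I A sh \<alpha> \<alpha>v sg br H E F sV act
  for I :: "'i set" and A :: "'i \<Rightarrow> 'i \<Rightarrow> int"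
    and sh :: "complex \<Rightarrow> 'h \<Rightarrow> 'h::ab_group_add"
    and \<alpha> :: "'i \<Rightarrow> 'h \<Rightarrow> complex" and \<alpha>v :: "'i \<Rightarrow> 'h"
    and sg :: "complex \<Rightarrow> 'g \<Rightarrow> 'g::ab_group_add" and br :: "'g \<Rightarrow> 'g \<Rightarrow> 'g"
    and H :: "'h \<Rightarrow> 'g" and E :: "'i \<Rightarrow> 'g" and F :: "'i \<Rightarrow> 'g"
    and sV :: "complex \<Rightarrow> 'v \<Rightarrow> 'v::ab_group_add" and act :: "'g \<Rightarrow> 'v \<Rightarrow> 'v" +
  fixes \<Lambda> :: "'h \<Rightarrow> complex" and v\<^sub>0 :: 'v
  assumes \<Lambda>_dual: "\<Lambda> \<in> dual sh"
    and v0_nonzero: "v\<^sub>0 \<noteq> 0" and e_v0: "i \<in> I \<Longrightarrow> act (E i) v\<^sub>0 = 0"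
    and v0_weight: "v\<^sub>0 \<in> weight_space H sV act \<Lambda>"
    and v0_generates: "submodule sV act hull {v\<^sub>0} = UNIV"
begin

section \<open>Monomials in the lowering operators\<close>

abbreviation mon :: "'i list \<Rightarrow> 'v" where "mon w \<equiv> foldr (\<lambda>i. act (F i)) w v\<^sub>0"

definition cnt :: "'i list \<Rightarrow> 'i \<Rightarrow> real" where "cnt w i = real (count_list w i)"

definition mwt :: "'i list \<Rightarrow> 'h \<Rightarrow> complex" where "mwt w = \<Lambda> - comb (cnt w)"

lemma cnt_Nil: "cnt [] = (\<lambda>i. 0)" and cnt_Cons: "cnt (j # w) = (\<lambda>i. cnt w i + (if i = j then 1 else 0))"
  by (auto simp: cnt_def fun_eq_iff)

lemma mwt_Nil [simp]: "mwt [] = \<Lambda>"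
  by (simp add: mwt_def cnt_Nil)

lemma mwt_Cons: "i \<in> I \<Longrightarrow> mwt (i # w) = mwt w - \<alpha> i"
  using comb_add[of "cnt w" "\<lambda>k. if k = i then 1 else 0"] comb_single[of i 1]
  by (simp add: mwt_def cnt_Cons)

lemma mwt_dual: "mwt w \<in> dualh"
  unfolding mwt_def by (intro dual_diff[OF vs_h] \<Lambda>_dual comb_dual)

lemma mwt_eq_iff: "mwt w = mwt u \<longleftrightarrow> (\<forall>i\<in>I. cnt w i = cnt u i)"
  using comb_inject[of "cnt w" "cnt u"] comb_cong[of "cnt w" "cnt u"] by (auto simp: mwt_def)

lemma mon_Wt: "w \<in> lists I \<Longrightarrow> mon w \<in> Wt (mwt w)"
proof (induction w)
  case Nil
  then show ?case using v0_weight by simp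
next
  case (Cons i w)
  then show "mon (i # w) \<in> Wt (mwt (i # w))"
    using f_Wt[of i "mon w" "mwt w"] by (simp add: mwt_Cons)
qed

lemma e_mon: "w \<in> lists I \<Longrightarrow> i \<in> I \<Longrightarrow> act (E i) (mon w) \<in> V.span (mon ` lists I)"
proof (induction w)
  case Nil
  then show ?case by (simp add: e_v0 V.span_zero)
next
  case (Cons j w)
  have w: "w \<in> lists I" "j \<in> I" using Cons.prems by auto
  have f: "act (F j) x \<in> V.span (mon ` lists I)" if "x \<in> V.span (mon ` lists I)" for x
    using that
  proof (induction rule: V.span_induct_alt)
    case (step c y z)
    then obtain u where "u \<in> lists I" "y = mon u" by auto
    then have "act (F j) y \<in> mon ` lists I" using w by (intro image_eqI[of _ _ "j # u"]) auto
    then show ?case using step by (simp add: V.act_add_right V.act_scale_right V.span_add V.span_scale V.span_base)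
  qed (simp add: V.span_zero)
  have "act (H h) (mon w) \<in> V.span (mon ` lists I)" for h
    using mon_Wt[OF w(1)] w by (auto simp: Wt_iff intro!: V.span_scale[OF V.span_base])
  then show ?case using f[OF Cons.IH[OF w(1) Cons.prems(2)]] w Cons.prems
    by (auto simp: act_e_f intro!: V.span_add)
qed

text \<open>The span is stable under all generators, by \<open>e_mon\<close> for the raising
  operators, so it is a submodule containing the generating vector.\<close>

lemma span_mon: "V.span (mon ` lists I) = UNIV"
proof -
  let ?N = "V.span (mon ` lists I)"
  have act_span: "act x v \<in> ?N" if "\<And>w. w \<in> lists I \<Longrightarrow> act x (mon w) \<in> ?N" "v \<in> ?N" for x v
    using that(2)
  proof (induction rule: V.span_induct_alt)
    case (step c y z)
    then show ?case using that(1)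
      by (auto simp: V.act_add_right V.act_scale_right intro!: V.span_add V.span_scale)
  qed (simp add: V.span_zero)
  have "submodule sV act ?N"
  proof (rule submoduleI)
    fix h v assume v: "v \<in> ?N"
    show "act (H h) v \<in> ?N"
    proof (rule act_span[OF _ v])
      fix w assume w: "w \<in> lists I"
      show "act (H h) (mon w) \<in> ?N"
        using mon_Wt[OF w] w by (auto simp: Wt_iff intro!: V.span_scale[OF V.span_base])
    qed
  next
    fix i v assume i: "i \<in> I" and v: "v \<in> ?N"
    show "act (E i) v \<in> ?N" by (rule act_span[OF e_mon[OF _ i] v])
    show "act (F i) v \<in> ?N"
    proof (rule act_span[OF _ v])
      fix w assume w: "w \<in> lists I"
      show "act (F i) (mon w) \<in> ?N"
        by (rule V.span_base, rule image_eqI[of _ _ "i # w"]) (use w i in auto)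
    qed
  qed simp
  moreover have "{v\<^sub>0} \<subseteq> ?N"
    by (simp, rule V.span_base, rule image_eqI[of _ _ "[]"]) auto
  ultimately show ?thesis using v0_generates hull_minimal[of "{v\<^sub>0}" ?N "submodule sV act"] by blast
qed

text \<open>Expand a weight vector in monomials and group them by weight. Independence of weight
  vectors leaves only the group of weight \<open>\<mu>\<close>.\<close>

lemma Wt_span: "Wt \<mu> = V.span (mon ` {w \<in> lists I. mwt w = \<mu>})"
proof (intro equalityI subsetI)
  fix x assume x: "x \<in> Wt \<mu>"
  have "x \<in> V.span (mon ` lists I)" by (simp add: span_mon)
  then obtain t r where t: "finite t" "t \<subseteq> mon ` lists I" "x = (\<Sum>a\<in>t. sV (r a) a)"
    by (auto simp: V.span_explicit)
  have "\<forall>a\<in>t. \<exists>w. w \<in> lists I \<and> a = mon w" using t(2) by blast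
  from bchoice[OF this] obtain g where g: "\<And>a. a \<in> t \<Longrightarrow> g a \<in> lists I \<and> a = mon (g a)"
    by blast
  let ?P = "\<lambda>\<nu>. V.span (mon ` {w \<in> lists I. mwt w = \<nu>})"
  define y where "y \<nu> = (\<Sum>a\<in>{a \<in> t. mwt (g a) = \<nu>}. sV (r a) a)" for \<nu>
  have P_Wt: "?P \<nu> \<subseteq> Wt \<nu>" for \<nu>
    using mon_Wt by (intro V.span_minimal subspace_Wt) auto
  have yP: "y \<nu> \<in> ?P \<nu>" for \<nu>
    unfolding y_def using g by (intro V.span_sum V.span_scale V.span_base) auto
  define S where "S = insert \<mu> ((\<lambda>a. mwt (g a)) ` t)"
  have S: "finite S" using t(1) by (simp add: S_def)
  \<comment> \<open>The weight components of \<open>x\<close> minus \<open>x\<close> itself, placed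
    in weight \<open>\<mu>\<close>; they sum to zero.\<close>
  define z where "z \<nu> = y \<nu> - (if \<nu> = \<mu> then x else 0)" for \<nu>
  have "(\<Sum>\<nu>\<in>S. y \<nu>) = x"
    unfolding y_def t(3) by (rule sum.group[OF t(1) S]) (auto simp: S_def)
  then have "(\<Sum>\<nu>\<in>S. z \<nu>) = 0"
    using S by (simp add: z_def sum_subtractf S_def)
  moreover have "z \<nu> \<in> Wt \<nu>" for \<nu>
    using P_Wt yP x subspace_Wt V.subspace_0[OF subspace_Wt]
    by (auto simp: z_def intro!: V.subspace_diff)
  ultimately have "z \<mu> = 0"
    using weight_vectors_independent[OF S, of z \<mu>] by (simp add: S_def)
  then show "x \<in> ?P \<mu>" using yP[of \<mu>] by (simp add: z_def)
next
  fix x assume "x \<in> V.span (mon ` {w \<in> lists I. mwt w = \<mu>})"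
  moreover have "V.span (mon ` {w \<in> lists I. mwt w = \<mu>}) \<subseteq> Wt \<mu>"
    using mon_Wt by (intro V.span_minimal subspace_Wt) auto
  ultimately show "x \<in> Wt \<mu>" by blast
qed

lemma length_cnt: "w \<in> lists I \<Longrightarrow> real (length w) = (\<Sum>i\<in>I. cnt w i)"
  using finite_I by (induction w) (auto simp: cnt_Nil cnt_Cons sum.distrib)

text \<open>A weight determines the letter counts of its words, hence their length, and there are
  finitely many words of given length.\<close>

lemma Wt_finite_span: "\<exists>B. finite B \<and> V.span B = Wt \<mu>"
proof -
  have "\<exists>n. {w \<in> lists I. mwt w = \<mu>} \<subseteq> {w. set w \<subseteq> I \<and> length w = n}"
  proof (cases "{w \<in> lists I. mwt w = \<mu>} = {}")
    case False
    then obtain u where u: "u \<in> lists I" "mwt u = \<mu>" by blast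
    have "length w = length u" if "w \<in> lists I" "mwt w = \<mu>" for w
      using length_cnt[OF that(1)] length_cnt[OF u(1)] that u(2) mwt_eq_iff[of w u] by auto
    then show ?thesis by (intro exI[of _ "length u"]) auto
  qed auto
  then have "finite {w \<in> lists I. mwt w = \<mu>}"
    using finite_lists_length_eq[OF finite_I] finite_subset by blast
  then show ?thesis using Wt_span by blast
qed

lemma Wt_\<Lambda>: "Wt \<Lambda> = V.span {v\<^sub>0}"
proof -
  have "w = []" if "w \<in> lists I" "mwt w = \<Lambda>" for w
  proof (rule ccontr)
    assume "w \<noteq> []"
    then obtain i u where iu: "w = i # u" by (cases w) auto
    then have "cnt w i = cnt [] i"
      using that mwt_eq_iff[of w "[]"] by (auto simp: cnt_Nil)
    then show False by (simp add: iu cnt_def)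
  qed
  then have "{w \<in> lists I. mwt w = \<Lambda>} = {[]}" by auto
  then show ?thesis using Wt_span[of \<Lambda>] by simp
qed

abbreviation weights :: "('h \<Rightarrow> complex) set" where "weights \<equiv> wt sh H sV act"

lemma Wt_nonzeroE:
  assumes "Wt \<mu> \<noteq> {0}"
  obtains w where "w \<in> lists I" "mwt w = \<mu>" "mon w \<noteq> 0"
proof -
  have "\<exists>w\<in>lists I. mwt w = \<mu> \<and> mon w \<noteq> 0"
  proof (rule ccontr)
    assume "\<not> ?thesis"
    then have "mon ` {w \<in> lists I. mwt w = \<mu>} \<subseteq> {0}" by auto
    then have "Wt \<mu> \<subseteq> V.span {0}" unfolding Wt_span by (rule V.span_mono)
    then have "Wt \<mu> \<subseteq> {0}" by simp
    then show False using assms V.subspace_0[OF subspace_Wt] by blast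
  qed
  with that show thesis by blast
qed

lemma weights_iff: "\<mu> \<in> weights \<longleftrightarrow> (\<exists>w\<in>lists I. mwt w = \<mu> \<and> mon w \<noteq> 0)"
proof
  assume "\<mu> \<in> weights"
  then show "\<exists>w\<in>lists I. mwt w = \<mu> \<and> mon w \<noteq> 0"
    using Wt_nonzeroE[of \<mu>] by (auto simp: wt_def)
next
  assume "\<exists>w\<in>lists I. mwt w = \<mu> \<and> mon w \<noteq> 0"
  then show "\<mu> \<in> weights" using mon_Wt mwt_dual by (auto simp: wt_def)
qed

lemma \<Lambda>_weight: "\<Lambda> \<in> weights"
  using v0_nonzero by (auto simp: weights_iff intro!: bexI[of _ "[]"])

text \<open>Since \<open>dim\<close> is 0 on infinite-dimensional spaces as well, the finite
  spanning set is what makes dimension 0 mean the zero space.\<close>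

lemma dim_Wt_pos: "\<mu> \<in> dualh \<Longrightarrow> \<mu> \<in> weights \<longleftrightarrow> V.dim (Wt \<mu>) \<noteq> 0"
proof -
  assume \<mu>: "\<mu> \<in> dualh"
  obtain B where B: "finite B" "V.span B = Wt \<mu>" using Wt_finite_span by blast
  have "V.dim (Wt \<mu>) = 0 \<longleftrightarrow> Wt \<mu> = {0}"
  proof
    assume d: "V.dim (Wt \<mu>) = 0"
    obtain C where C: "C \<subseteq> Wt \<mu>" "V.independent C" "Wt \<mu> \<subseteq> V.span C" "card C = V.dim (Wt \<mu>)"
      using V.basis_exists by blast
    have "finite C" using V.independent_span_bound[OF B(1) C(2)] C(1) B(2) by blast
    then have "C = {}" using C(4) d by simp
    then show "Wt \<mu> = {0}" using C(3) V.subspace_0[OF subspace_Wt] by auto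
  next
    assume "Wt \<mu> = {0}"
    then show "V.dim (Wt \<mu>) = 0" using V.dim_le_card[of "Wt \<mu>" "{}"] by simp
  qed
  then show ?thesis using \<mu> by (simp add: wt_def)
qed

section \<open>Integrability and Weyl group symmetry\<close>

abbreviation IV :: "'i set" where "IV \<equiv> integrability I F act"

lemma IV_subset: "IV \<subseteq> I" by (auto simp: integrability_def)

text \<open>The vectors killed by some power of \<open>F i\<close> form a subspace that every
  \<open>F j\<close> preserves, since \<open>F i\<close> is ad-nilpotent on \<open>F j\<close>. If
  it contains the generator, it contains all monomials.\<close>

lemma IV_iff: "i \<in> IV \<longleftrightarrow> i \<in> I \<and> (\<exists>n. (act (F i) ^^ n) v\<^sub>0 = 0)"
proof
  assume i: "i \<in> I \<and> (\<exists>n. (act (F i) ^^ n) v\<^sub>0 = 0)"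
  have pow_mono: "(act (F i) ^^ n) x = 0" if "(act (F i) ^^ m) x = 0" "m \<le> n" for m n x
    using that by (metis act_pow_zero funpow_add le_add_diff_inverse2 o_apply)
  let ?L = "{x. \<exists>n. (act (F i) ^^ n) x = 0}"
  have "V.subspace ?L"
  proof (rule V.subspaceI)
    fix x y assume "x \<in> ?L" "y \<in> ?L"
    then obtain m n where "(act (F i) ^^ m) x = 0" "(act (F i) ^^ n) y = 0" by blast
    then have "(act (F i) ^^ (max m n)) (x + y) = 0"
      using pow_mono[of m x "max m n"] pow_mono[of n y "max m n"] by (simp add: act_pow_add)
    then show "x + y \<in> ?L" by blast
  next
    fix c x assume "x \<in> ?L"
    then show "sV c x \<in> ?L" by (auto simp: act_pow_scale)
  qed auto
  moreover have "mon w \<in> ?L" if "w \<in> lists I" for w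
    using that
  proof (induction w)
    case Nil
    show ?case using i by simp
  next
    case (Cons j w)
    then obtain n where "(act (F i) ^^ n) (mon w) = 0" by auto
    moreover obtain m where "(br (F i) ^^ m) (F j) = 0" using f_ad_nilpotent i Cons.hyps by blast
    ultimately have "(act (F i) ^^ (m + n)) (act (F j) (mon w)) = 0" by (intro leibniz_nilpotent)
    then show ?case by auto
  qed
  ultimately have "V.span (mon ` lists I) \<subseteq> ?L" by (intro V.span_minimal) auto
  then have "?L = UNIV" using span_mon by blast
  then show "i \<in> IV" using i by (auto simp: integrability_def)
qed (auto simp: integrability_def)

lemma mon_replicate: "mon (replicate n i) = (act (F i) ^^ n) v\<^sub>0"
  by (induction n) simp_all

text \<open>Take the least vanishing power \<open>n + 1\<close> and apply \<open>E i\<close>: the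
  scalar \<open>(n + 1) * (\<Lambda> (\<alpha>v i) - n)\<close> must be zero, because the power
  \<open>n\<close> is not.\<close>

lemma IV_integral:
  assumes "i \<in> IV"
  obtains n where "\<Lambda> (\<alpha>v i) = of_nat n" "(act (F i) ^^ Suc n) v\<^sub>0 = 0"
proof -
  have i: "i \<in> I" and "\<exists>N. (act (F i) ^^ N) v\<^sub>0 = 0" using assms IV_iff by auto
  then obtain N where N: "(act (F i) ^^ N) v\<^sub>0 = 0" "\<And>n. n < N \<Longrightarrow> (act (F i) ^^ n) v\<^sub>0 \<noteq> 0"
    using exists_least_iff[of "\<lambda>N. (act (F i) ^^ N) v\<^sub>0 = 0"] by blast
  then obtain n where n: "N = Suc n" using v0_nonzero by (cases N) auto
  interpret sl: sl2_string sV "act (E i)" "act (F i)" "\<lambda>k. Wt (\<Lambda> + fscale (of_int k) (\<alpha> i))" "\<Lambda> (\<alpha>v i)"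
    using sl2_string_e[OF i] .
  have "\<Lambda> + fscale (of_int 0) (\<alpha> i) = \<Lambda>" by (simp add: fun_eq_iff)
  then have "act (E i) ((act (F i) ^^ Suc n) v\<^sub>0) =
      sV (of_nat (Suc n) * (\<Lambda> (\<alpha>v i) + 2 * of_int 0 - of_nat n)) ((act (F i) ^^ n) v\<^sub>0)"
    using v0_weight e_v0[OF i] by (intro sl.e_f_pow) simp_all
  then have "sV (of_nat (Suc n) * (\<Lambda> (\<alpha>v i) - of_nat n)) ((act (F i) ^^ n) v\<^sub>0) = 0"
    using N(1) n by simp
  then have "\<Lambda> (\<alpha>v i) = of_nat n"
    using N(2)[of n] n by (simp del: of_nat_Suc)
  then show thesis using that N(1) n by simp
qed

lemma mwt_coroot: "i \<in> I \<Longrightarrow> mwt w (\<alpha>v i) = \<Lambda> (\<alpha>v i) - of_int (\<Sum>j\<in>I. int (count_list w j) * A i j)"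
  by (simp add: mwt_def comb_coroot cnt_def)

lemma weight_integral:
  assumes "i \<in> IV" "w \<in> lists I"
  shows "mwt w (\<alpha>v i) \<in> \<int>"
  using IV_integral[OF assms(1)] mwt_coroot[of i w] IV_subset assms(1)
  by (metis Ints_diff Ints_of_int Ints_of_nat subsetD)

text \<open>Each application of \<open>E i\<close> lowers by one the number of letters
  \<open>i\<close> in words of the weight, and this number cannot become negative.\<close>

lemma e_locally_nilpotent:
  assumes "i \<in> I" "x \<in> Wt \<mu>"
  shows "\<exists>N. (act (E i) ^^ N) x = 0"
proof (cases "Wt \<mu> = {0}")
  case True
  then show ?thesis using assms by (intro exI[of _ 0]) simp
next
  case False
  then obtain w where w: "w \<in> lists I" "mwt w = \<mu>" using Wt_nonzeroE by metis
  define N where "N = Suc (count_list w i)"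
  interpret sl: sl2_string sV "act (E i)" "act (F i)" "\<lambda>k. Wt (\<mu> + fscale (of_int k) (\<alpha> i))" "\<mu> (\<alpha>v i)"
    using sl2_string_e[OF assms(1)] .
  have "\<mu> + fscale (of_int 0) (\<alpha> i) = \<mu>" by (simp add: fun_eq_iff)
  then have mem: "(act (E i) ^^ N) x \<in> Wt (\<mu> + fscale (of_int (int N)) (\<alpha> i))"
    using sl.e_pow_U[of x 0 N] assms(2) by simp
  have "Wt (\<mu> + fscale (of_int (int N)) (\<alpha> i)) = {0}"
  proof (rule ccontr)
    assume "\<not> ?thesis"
    then obtain u where u: "u \<in> lists I" "mwt u = \<mu> + fscale (of_int (int N)) (\<alpha> i)"
      by (metis Wt_nonzeroE)
    have "mwt u (\<omega> i) = mwt w (\<omega> i) + of_nat N"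
      using assms(1) by (simp add: u w root_\<omega>)
    then have "cnt u i = cnt w i - real N"
      using assms(1) by (simp add: mwt_def comb_\<omega> complex_eq_iff)
    then show False by (simp add: cnt_def N_def)
  qed
  then show ?thesis using mem by auto
qed

text \<open>The space at the reflected weight maps onto \<open>Wt \<mu>\<close> by a power of
  \<open>E i\<close> or of \<open>F i\<close>, according to the sign of the pairing; this is
  \<open>e_pow_onto\<close>. As reflections are involutions, equality follows.\<close>

lemma dim_Wt_rfl_le:
  assumes i: "i \<in> IV"
  shows "V.dim (Wt \<mu>) \<le> V.dim (Wt (rfl i \<mu>))"
proof (cases "Wt \<mu> = {0}")
  case True
  then show ?thesis using V.dim_le_card[of "Wt \<mu>" "{}"] by simp
next
  case False
  then obtain w where w: "w \<in> lists I" "mwt w = \<mu>" by (metis Wt_nonzeroE)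
  then obtain p where p: "\<mu> (\<alpha>v i) = of_int p"
    using weight_integral[OF i w(1)] by (auto elim: Ints_cases)
  have iI: "i \<in> I" using i IV_subset by blast
  have zero: "\<mu> + fscale (of_int 0) (\<alpha> i) = \<mu>" "\<mu> - fscale (of_int 0) (\<alpha> i) = \<mu>"
    by (simp_all add: fun_eq_iff)
  have onto: "\<exists>x n. Wt \<mu> \<subseteq> (act x ^^ n) ` Wt (rfl i \<mu>)"
  proof (cases "0 \<le> p")
    case True
    define m where "m = nat p"
    interpret sl: sl2_string sV "act (E i)" "act (F i)" "\<lambda>k. Wt (\<mu> + fscale (of_int k) (\<alpha> i))" "\<mu> (\<alpha>v i)"
      using sl2_string_e[OF iI] .
    have c: "\<mu> (\<alpha>v i) = of_nat m" using p True by (simp add: m_def)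
    have "\<mu> + fscale (of_int (0 - int m)) (\<alpha> i) = rfl i \<mu>"
      by (simp add: rfl_def c fun_eq_iff)
    then have "(act (F i) ^^ m) z \<in> Wt (rfl i \<mu>)" if "z \<in> Wt \<mu>" for z
      using sl.f_pow_U[of z 0 m] that zero by simp
    moreover have "\<exists>z\<in>Wt \<mu>. x = (act (E i) ^^ m) ((act (F i) ^^ m) z)" if "x \<in> Wt \<mu>" for x
      using sl.e_pow_onto[OF c, of x] e_locally_nilpotent[OF iI] that unfolding zero by blast
    ultimately have "Wt \<mu> \<subseteq> (act (E i) ^^ m) ` Wt (rfl i \<mu>)" by blast
    then show ?thesis by blast
  next
    case False
    define m where "m = nat (- p)"
    interpret sl: sl2_string sV "act (F i)" "act (E i)" "\<lambda>k. Wt (\<mu> - fscale (of_int k) (\<alpha> i))" "- \<mu> (\<alpha>v i)"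
      using sl2_string_f[OF iI] .
    have c: "- \<mu> (\<alpha>v i) = of_nat m" using p False by (simp add: m_def)
    have "\<mu> (\<alpha>v i) = - of_nat m" using c by (metis add.inverse_inverse)
    then have "\<mu> - fscale (of_int (0 - int m)) (\<alpha> i) = rfl i \<mu>"
      by (simp add: rfl_def fun_eq_iff)
    then have "(act (E i) ^^ m) z \<in> Wt (rfl i \<mu>)" if "z \<in> Wt \<mu>" for z
      using sl.f_pow_U[of z 0 m] that zero by simp
    moreover have "\<exists>z\<in>Wt \<mu>. x = (act (F i) ^^ m) ((act (E i) ^^ m) z)" if "x \<in> Wt \<mu>" for x
      using sl.e_pow_onto[OF c, of x] i that unfolding zero integrability_def by blast
    ultimately have "Wt \<mu> \<subseteq> (act (F i) ^^ m) ` Wt (rfl i \<mu>)" by blast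
    then show ?thesis by blast
  qed
  then obtain x n where xn: "Wt \<mu> \<subseteq> (act x ^^ n) ` Wt (rfl i \<mu>)" by blast
  obtain B where B: "finite B" "V.span B = Wt (rfl i \<mu>)" using Wt_finite_span by blast
  obtain C where C: "C \<subseteq> Wt (rfl i \<mu>)" "V.independent C" "Wt (rfl i \<mu>) \<subseteq> V.span C"
    "card C = V.dim (Wt (rfl i \<mu>))"
    using V.basis_exists by blast
  have fin: "finite C" using V.independent_span_bound[OF B(1) C(2)] C(1) B(2) by blast
  have "(act x ^^ n) z \<in> V.span ((act x ^^ n) ` C)" if "z \<in> V.span C" for z
    using that
  proof (induction rule: V.span_induct_alt)
    case (step c y z)
    then show ?case by (simp add: act_pow_add act_pow_scale V.span_add V.span_scale V.span_base)
  qed (simp add: V.span_zero)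
  then have "Wt \<mu> \<subseteq> V.span ((act x ^^ n) ` C)" using xn C(3) by blast
  then have "V.dim (Wt \<mu>) \<le> card ((act x ^^ n) ` C)" using fin by (intro V.dim_le_card) auto
  also have "\<dots> \<le> V.dim (Wt (rfl i \<mu>))" using card_image_le[OF fin] C(4) by metis
  finally show ?thesis .
qed

lemma dim_Wt_rfl: "i \<in> IV \<Longrightarrow> V.dim (Wt (rfl i \<mu>)) = V.dim (Wt \<mu>)"
  using dim_Wt_rfl_le[of i \<mu>] dim_Wt_rfl_le[of i "rfl i \<mu>"] IV_subset by fastforce

lemma dim_Wt_wact: "w \<in> lists IV \<Longrightarrow> V.dim (Wt (wact w \<mu>)) = V.dim (Wt \<mu>)"
  by (induction w) (auto simp: dim_Wt_rfl)

lemma weights_dual: "\<mu> \<in> weights \<Longrightarrow> \<mu> \<in> dualh"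
  by (simp add: wt_def)

lemma weights_rfl: "i \<in> IV \<Longrightarrow> \<mu> \<in> weights \<Longrightarrow> rfl i \<mu> \<in> weights"
  using dim_Wt_pos[of \<mu>] dim_Wt_pos[of "rfl i \<mu>"] dim_Wt_rfl[of i \<mu>] rfl_dual[of i \<mu>] IV_subset weights_dual
  by auto

lemma string_weights:
  assumes "i \<in> I" "i \<notin> IV"
  shows "\<Lambda> - comb (\<lambda>k. if k = i then real n else 0) \<in> weights"
proof -
  have "count_list (replicate n i) k = (if k = i then n else 0)" for k
    by (induction n) auto
  then have "cnt (replicate n i) = (\<lambda>k. if k = i then real n else 0)"
    by (simp add: cnt_def fun_eq_iff)
  then have "mwt (replicate n i) = \<Lambda> - comb (\<lambda>k. if k = i then real n else 0)"
    by (simp add: mwt_def)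
  moreover have "mon (replicate n i) \<noteq> 0" using assms IV_iff by (auto simp: mon_replicate)
  moreover have "replicate n i \<in> lists I" using assms by auto
  ultimately show ?thesis unfolding weights_iff by blast
qed

text \<open>
  The weights are nondegenerate with respect to \<open>\<Lambda>\<close> in the sense of Kac: the \<open>f\<^sub>j\<close> with \<open>j \<in> R\<close> commute
  past the remaining factors of the monomial and kill the highest weight vector.
\<close>

lemma mon_degenerate:
  assumes w: "w \<in> lists I" and R: "R \<subseteq> IV" "R \<inter> set w \<noteq> {}" "\<And>j. j \<in> R \<Longrightarrow> \<Lambda> (\<alpha>v j) = 0"
    "\<And>j k. j \<in> R \<Longrightarrow> k \<in> set w - R \<Longrightarrow> A j k = 0"
  shows "mon w = 0"
  using w R(2,4)
proof (induction w)
  case (Cons k w)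
  have A0: "\<And>l. k \<in> R \<Longrightarrow> l \<in> set w \<Longrightarrow> l \<notin> R \<Longrightarrow> A k l = 0"
    using Cons.prems(2) by simp
  show "mon (k # w) = 0"
  proof (cases "R \<inter> set w = {}")
    case False
    have "mon w = 0" by (rule Cons.IH[OF False]) (use Cons.prems(2) in simp)
    then show ?thesis by simp
  next
    case True
    then have k: "k \<in> R" "k \<in> I" and w: "w \<in> lists I" using Cons.prems(1) Cons.hyps by auto
    obtain n where "\<Lambda> (\<alpha>v k) = of_nat n" "(act (F k) ^^ Suc n) v\<^sub>0 = 0"
      using IV_integral k R(1) by blast
    then have kill: "act (F k) v\<^sub>0 = 0" using R(3)[OF k(1)] by simp
    have "act (F k) (mon u) = 0" if "set u \<subseteq> set w" for u
      using that
    proof (induction u)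
      case (Cons l u)
      then have l: "l \<in> set w" "set u \<subseteq> set w" by auto
      then have "l \<notin> R" "l \<in> I" using True w by auto
      then have "act (F k) (act (F l) (mon u)) = act (F l) (act (F k) (mon u))"
        using k A0[OF k(1) l(1)] by (intro act_f_commute) auto
      then show ?case using Cons.IH[OF l(2)] by simp
    qed (simp add: kill)
    then show ?thesis by simp
  qed
qed simp

end

section \<open>The convex hull of the weights\<close>

context realization
begin

text \<open>
  A maximal \<open>b \<le> c\<close> with \<open>\<Lambda> - \<Sum> b\<^sub>i \<alpha>\<^sub>i\<close> in \<open>T\<close> must equal \<open>c\<close>: otherwise the indices in \<open>J\<close> at which the
  ratio of \<open>b\<^sub>j\<close> to \<open>c\<^sub>j - b\<^sub>j\<close> is least form a degenerate set \<open>R\<close>.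
\<close>

lemma dominant_nondegenerate_in_convex:
  fixes L :: "'i \<Rightarrow> int" and c :: "'i \<Rightarrow> nat"
  assumes J: "J \<subseteq> I" and T: "convex T" and T_rfl: "\<And>j \<mu>. j \<in> J \<Longrightarrow> \<mu> \<in> T \<Longrightarrow> rfl j \<mu> \<in> T"
    and L: "\<And>j. j \<in> J \<Longrightarrow> \<Lambda> (\<alpha>v j) = of_int (L j)" "\<And>j. j \<in> J \<Longrightarrow> 0 \<le> L j"
    and start: "\<Lambda> - comb (\<lambda>i. if i \<in> J then 0 else real (c i)) \<in> T"
    and dom: "\<And>j. j \<in> J \<Longrightarrow> (\<Sum>i\<in>I. int (c i) * A j i) \<le> L j"
    and nondeg: "\<And>R. R \<subseteq> J \<Longrightarrow> R \<noteq> {} \<Longrightarrow>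
      (\<And>j. j \<in> R \<Longrightarrow> L j = 0 \<and> 0 < c j \<and> (\<forall>k\<in>I - R. 0 < c k \<longrightarrow> A j k = 0)) \<Longrightarrow> False"
  shows "\<Lambda> - comb (\<lambda>i. real (c i)) \<in> T"
proof -
  define P where "P b \<longleftrightarrow> (\<forall>i\<in>I - J. b i = c i) \<and> (\<forall>i\<in>I. b i \<le> c i) \<and> \<Lambda> - comb (\<lambda>i. real (b i)) \<in> T"
    for b :: "'i \<Rightarrow> nat"
  have *: "(\<lambda>i. real (if i \<in> J then 0 else c i)) = (\<lambda>i. if i \<in> J then 0 else real (c i))"
    by auto
  have P0: "P (\<lambda>i. if i \<in> J then 0 else c i)"
    unfolding P_def * using start by simp
  have "\<forall>b. P b \<longrightarrow> (\<Sum>i\<in>I. b i) < Suc (\<Sum>i\<in>I. c i)"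
    unfolding P_def less_Suc_eq_le by (blast intro: sum_mono)
  from ex_has_greatest_nat[of P, OF P0 this] obtain b
    where b: "P b" "\<And>b'. P b' \<Longrightarrow> (\<Sum>i\<in>I. b' i) \<le> (\<Sum>i\<in>I. b i)"
    by blast
  have bc: "\<And>i. i \<in> I \<Longrightarrow> b i \<le> c i" "\<And>i. i \<in> I \<Longrightarrow> i \<notin> J \<Longrightarrow> b i = c i"
    and bT: "\<Lambda> - comb (\<lambda>i. real (b i)) \<in> T"
    using b(1) unfolding P_def by blast+
  define K where "K = {j \<in> J. b j < c j}"
  show ?thesis
  proof (cases "K = {}")
    case True
    then have "b i = c i" if "i \<in> I" for i
      using bc[OF that] that by (cases "i \<in> J") (auto simp: K_def)
    then have "comb (\<lambda>i. real (b i)) = comb (\<lambda>i. real (c i))" by (intro comb_cong) simp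
    then show ?thesis using bT by simp
  next
    case False
    \<comment> \<open>Otherwise the pairing \<open>p\<close> is positive, and the point with one
      more \<alpha> of \<open>j\<close> subtracted divides the segment to the mirror image in ratio
      \<open>1 / p\<close>; then \<open>b\<close> was not maximal.\<close>
    have step: "L j \<le> (\<Sum>i\<in>I. int (b i) * A j i)" if j: "j \<in> K" for j
    proof (rule ccontr)
      assume neg: "\<not> ?thesis"
      define p where "p = L j - (\<Sum>i\<in>I. int (b i) * A j i)"
      have p: "1 \<le> p" using neg by (simp add: p_def)
      have jI: "j \<in> J" "j \<in> I" "b j < c j" using j J by (auto simp: K_def)
      define \<nu> where "\<nu> = \<Lambda> - comb (\<lambda>i. real (b i))"
      define b' where "b' = b(j := Suc (b j))"
      have "\<nu> (\<alpha>v j) = of_int p"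
        using jI by (simp add: \<nu>_def comb_coroot L p_def)
      then have r: "rfl j \<nu> = \<nu> - fscale (of_int p) (\<alpha> j)" by (simp add: rfl_def)
      have "real (b' i) = real (b i) + (if i = j then 1 else 0)" for i by (simp add: b'_def)
      then have "comb (\<lambda>i. real (b' i)) = comb (\<lambda>i. real (b i)) + \<alpha> j"
        using comb_add[of "\<lambda>i. real (b i)" "\<lambda>k. if k = j then 1 else 0"] comb_single[OF jI(2), of 1]
        by simp
      then have "\<Lambda> - comb (\<lambda>i. real (b' i)) = \<nu> - \<alpha> j"
        by (simp add: \<nu>_def fun_eq_iff)
      also have "\<dots> = (1 - 1 / real_of_int p) *\<^sub>R \<nu> + (1 / real_of_int p) *\<^sub>R rfl j \<nu>"
        unfolding r using p
        by (simp add: fun_eq_iff scaleR_fun_def scaleR_conv_of_real field_simps)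
      also have "\<dots> \<in> T"
        using p bT T_rfl[OF jI(1)] by (intro convexD[OF T]) (auto simp: \<nu>_def)
      finally have "P b'" using b(1) jI by (auto simp: P_def b'_def)
      moreover have "(\<Sum>i\<in>I. b i) < (\<Sum>i\<in>I. b' i)"
        using finite_I jI(2) by (intro sum_strict_mono_ex1) (auto simp: b'_def)
      ultimately show False using b(2) by fastforce
    qed
    define u where "u i = real (c i) - real (b i)" for i
    have K_fin: "finite K" using finite_I J by (auto simp: K_def intro: finite_subset)
    have uK: "0 < u i" if "i \<in> K" for i using that by (simp add: u_def K_def)
    have u0: "u i = 0" if "i \<in> I" "i \<notin> K" for i
      using that bc[OF that(1)] by (cases "i \<in> J") (auto simp: u_def K_def)
    \<comment> \<open>The largest \<open>s\<close> for which \<open>b - s * u\<close> stays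
      nonnegative; \<open>R\<close> collects the indices in \<open>K\<close> at which it becomes
      zero.\<close>
    define s where "s = Min ((\<lambda>i. real (b i) / u i) ` K)"
    define z where "z i = real (b i) - s * u i" for i
    define R where "R = {j \<in> K. z j = 0}"
    have "s \<in> (\<lambda>i. real (b i) / u i) ` K" unfolding s_def using K_fin False by (intro Min_in) auto
    then obtain j0 where j0: "j0 \<in> K" "s = real (b j0) / u j0" by blast
    have s0: "0 \<le> s" using j0 uK[OF j0(1)] by simp
    have "z j0 = 0" using j0 uK[OF j0(1)] by (simp add: z_def)
    then have R_ne: "R \<noteq> {}" using j0 by (auto simp: R_def)
    have zK: "0 \<le> z i" if "i \<in> K" for i
    proof -
      have "s \<le> real (b i) / u i" unfolding s_def using K_fin that by (intro Min_le) auto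
      then show ?thesis using uK[OF that] by (simp add: z_def pos_le_divide_eq)
    qed
    have z0: "0 \<le> z i" if "i \<in> I" for i
      using zK u0[OF that] by (cases "i \<in> K") (auto simp: z_def)
    \<comment> \<open>Dominance of \<open>c\<close> and \<open>step\<close> give
      \<open>A u \<le> 0\<close> on \<open>K\<close>, so row \<open>j\<close> of \<open>A z\<close>
      is at least \<open>L j \<ge> 0\<close>. As \<open>z j = 0\<close>, every summand is
      nonpositive; hence all of them and \<open>L j\<close> vanish.\<close>
    have "L j = 0 \<and> 0 < c j \<and> (\<forall>k\<in>I - R. 0 < c k \<longrightarrow> A j k = 0)" if "j \<in> R" for j
    proof -
      have j: "j \<in> K" "j \<in> J" "j \<in> I" "z j = 0" using that J by (auto simp: R_def K_def)
      have "(\<Sum>i\<in>I. real_of_int (A j i) * u i) =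
          real_of_int (\<Sum>i\<in>I. int (c i) * A j i) - real_of_int (\<Sum>i\<in>I. int (b i) * A j i)"
        by (simp add: u_def algebra_simps sum_subtractf)
      also have "\<dots> \<le> 0" using dom[OF j(2)] step[OF j(1)] by linarith
      finally have "s * (\<Sum>i\<in>I. real_of_int (A j i) * u i) \<le> 0"
        using s0 by (simp add: mult_nonneg_nonpos)
      moreover have "(\<Sum>i\<in>I. real_of_int (A j i) * z i) =
          real_of_int (\<Sum>i\<in>I. int (b i) * A j i) - s * (\<Sum>i\<in>I. real_of_int (A j i) * u i)"
        by (simp add: z_def algebra_simps sum_subtractf sum_distrib_left)
      moreover have "real_of_int (L j) \<le> real_of_int (\<Sum>i\<in>I. int (b i) * A j i)"
        using step[OF j(1)] by linarith
      ultimately have ge: "real_of_int (L j) \<le> (\<Sum>i\<in>I. real_of_int (A j i) * z i)"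
        by linarith
      have le: "real_of_int (A j i) * z i \<le> 0" if "i \<in> I" for i
        using off_diag[OF j(3) that] z0[OF that] j(4) by (cases "i = j") (auto simp: mult_nonpos_nonneg)
      have sum_le: "(\<Sum>i\<in>I. real_of_int (A j i) * z i) \<le> 0" by (rule sum_nonpos) (rule le)
      have Lj: "L j = 0" using ge sum_le L(2)[OF j(2)] by linarith
      then have "(\<Sum>i\<in>I. - (real_of_int (A j i) * z i)) = 0"
        using ge sum_le by (simp add: sum_negf)
      then have "\<forall>i\<in>I. - (real_of_int (A j i) * z i) = 0"
        using sum_nonneg_eq_0_iff[OF finite_I, of "\<lambda>i. - (real_of_int (A j i) * z i)"] le by force
      then have zero: "A j k = 0 \<or> z k = 0" if "k \<in> I" for k using that by fastforce
      have "A j k = 0" if k: "k \<in> I - R" "0 < c k" for k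
      proof -
        have "z k \<noteq> 0"
        proof (cases "k \<in> K")
          case True
          then show ?thesis using k by (auto simp: R_def)
        next
          case False
          then have "u k = 0" using u0 k by simp
          then show ?thesis using k by (simp add: z_def u_def)
        qed
        then show ?thesis using zero k by blast
      qed
      then show ?thesis using Lj j(1) by (auto simp: K_def)
    qed
    then have False using nondeg[of R] R_ne by (auto simp: R_def K_def)
    then show ?thesis ..
  qed
qed

text \<open>With \<open>D\<close> the total of the coefficients, the point is the average of the ray
  points at distance \<open>D\<close>, weighted by \<open>c i / D\<close>.\<close>

lemma cone_in_convex:
  fixes c :: "'i \<Rightarrow> nat"
  assumes "K \<subseteq> I" "convex T" "\<Lambda> \<in> T"
    and rays: "\<And>i n. i \<in> K \<Longrightarrow> \<Lambda> - comb (\<lambda>k. if k = i then real n else 0) \<in> T"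
  shows "\<Lambda> - comb (\<lambda>i. if i \<in> K then real (c i) else 0) \<in> T"
proof -
  have fin: "finite K" using assms(1) finite_I finite_subset by blast
  define D where "D = (\<Sum>i\<in>K. c i)"
  show ?thesis
  proof (cases "D = 0")
    case True
    then have "(\<lambda>i. if i \<in> K then real (c i) else 0) = (\<lambda>i. 0)"
      using fin by (auto simp: D_def fun_eq_iff)
    then show ?thesis using assms(3) by (simp only: comb_0) simp
  next
    case False
    have one: "(\<Sum>i\<in>K. real (c i) / real D) = 1"
    proof -
      have "(\<Sum>i\<in>K. real (c i) / real D) = real D / real D"
        unfolding sum_divide_distrib[symmetric] by (simp add: D_def)
      then show ?thesis using False by simp
    qed
    have "(\<Sum>i\<in>K. (real (c i) / real D) *\<^sub>R (\<Lambda> - comb (\<lambda>k. if k = i then real D else 0))) \<in> T"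
      using fin assms(2) one by (rule convex_sum) (auto intro: rays)
    also have "(\<Sum>i\<in>K. (real (c i) / real D) *\<^sub>R (\<Lambda> - comb (\<lambda>k. if k = i then real D else 0)))
      = (\<Sum>i\<in>K. (real (c i) / real D) *\<^sub>R \<Lambda>) - (\<Sum>i\<in>K. fscale (of_nat (c i)) (\<alpha> i))"
      unfolding sum_subtractf[symmetric]
      using False assms(1)
      by (intro sum.cong refl) (auto simp: comb_single subset_iff fun_eq_iff scaleR_fun_def scaleR_conv_of_real algebra_simps)
    also have "(\<Sum>i\<in>K. (real (c i) / real D) *\<^sub>R \<Lambda>) = \<Lambda>"
      by (simp only: one flip: scaleR_left.sum) simp
    also have "(\<Sum>i\<in>K. fscale (of_nat (c i)) (\<alpha> i)) = comb (\<lambda>i. if i \<in> K then real (c i) else 0)"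
    proof
      fix h
      have "(\<Sum>i\<in>K. fscale (of_nat (c i)) (\<alpha> i)) h = (\<Sum>i\<in>K. of_nat (c i) * \<alpha> i h)"
        using fin by (induction K) auto
      also have "\<dots> = (\<Sum>i\<in>I. of_real (if i \<in> K then real (c i) else 0) * \<alpha> i h)"
        using assms(1) finite_I by (intro sum.mono_neutral_cong_left) auto
      finally show "(\<Sum>i\<in>K. fscale (of_nat (c i)) (\<alpha> i)) h = comb (\<lambda>i. if i \<in> K then real (c i) else 0) h"
        by (simp add: comb_def)
    qed
    finally show ?thesis .
  qed
qed

lemma convex_hull_rfl:
  assumes "\<And>\<mu>. \<mu> \<in> S \<Longrightarrow> rfl j \<mu> \<in> S" "\<mu> \<in> convex hull S"
  shows "rfl j \<mu> \<in> convex hull S"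
proof -
  have "rfl j \<mu> \<in> rfl j ` (convex hull S)" using assms(2) by blast
  also have "\<dots> = convex hull (rfl j ` S)" by (rule convex_hull_linear_image[OF linear_rfl])
  also have "\<dots> \<subseteq> convex hull S" using assms(1) by (intro hull_mono) auto
  finally show ?thesis .
qed

end

context km_highest_weight_module
begin

text \<open>Induction on the word length. A negative pairing, that is \<open>0 < p j\<close>, lets a
  reflection produce a weight with a shorter word. Otherwise the weight is dominant for
  \<open>IV\<close>, and a nonzero monomial excludes degenerate sets by
  \<open>mon_degenerate\<close>.\<close>

lemma weights_in_convex:
  assumes T: "convex T" and T_rfl: "\<And>j \<mu>. j \<in> IV \<Longrightarrow> \<mu> \<in> T \<Longrightarrow> rfl j \<mu> \<in> T"
    and "\<Lambda> \<in> T"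
    and rays: "\<And>i n. i \<in> I - IV \<Longrightarrow> \<Lambda> - comb (\<lambda>k. if k = i then real n else 0) \<in> T"
  shows "weights \<subseteq> T"
proof -
  have "mwt w \<in> T" if "w \<in> lists I" "mon w \<noteq> 0" for w
    using that
  proof (induction "length w" arbitrary: w rule: less_induct)
    case less
    have "\<forall>j. \<exists>n. j \<in> IV \<longrightarrow> \<Lambda> (\<alpha>v j) = of_nat n" using IV_integral by metis
    then obtain n where "\<forall>j. j \<in> IV \<longrightarrow> \<Lambda> (\<alpha>v j) = of_nat (n j)" by metis
    then have L: "\<And>j. j \<in> IV \<Longrightarrow> \<Lambda> (\<alpha>v j) = of_int (int (n j))" by simp
    define p where "p j = (\<Sum>i\<in>I. int (count_list w i) * A j i) - int (n j)" for j
    have pairing_w: "mwt w (\<alpha>v j) = of_int (- p j)" if "j \<in> IV" for j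
      using that IV_subset L[OF that] by (simp add: mwt_coroot subset_iff p_def)
    show "mwt w \<in> T"
    proof (cases "\<exists>j\<in>IV. 0 < p j")
      case True
      then obtain j where j: "j \<in> IV" "0 < p j" by blast
      then have jI: "j \<in> I" using IV_subset by blast
      have "rfl j (mwt w) \<in> weights"
        using less.prems j(1) by (intro weights_rfl) (auto simp: weights_iff)
      then obtain u where u: "u \<in> lists I" "mwt u = rfl j (mwt w)" "mon u \<noteq> 0"
        by (auto simp: weights_iff)
      have "comb (cnt u) = comb (\<lambda>i. cnt w i - (if i = j then real_of_int (p j) else 0))"
      proof
        fix h
        have "mwt u h = mwt w h - mwt w (\<alpha>v j) * \<alpha> j h" by (simp add: u(2) rfl_apply)
        then show "comb (cnt u) h = comb (\<lambda>i. cnt w i - (if i = j then real_of_int (p j) else 0)) h"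
          unfolding pairing_w[OF j(1)]
          by (simp add: mwt_def comb_diff comb_single[OF jI]) (metis minus_diff_eq minus_minus)
      qed
      then have "cnt u i = cnt w i - (if i = j then real_of_int (p j) else 0)" if "i \<in> I" for i
        using comb_inject that by fastforce
      then have "real (length u) = real (length w) - real_of_int (p j)"
        using finite_I jI by (simp add: length_cnt[OF u(1)] length_cnt[OF less.prems(1)] sum_subtractf)
      then have "length u < length w" using j(2) by linarith
      then have "mwt u \<in> T" using less.hyps u by blast
      then have "rfl j (mwt u) \<in> T" using T_rfl j by blast
      then show ?thesis using u(2) jI by simp
    next
      case False
      have "\<Lambda> - comb (\<lambda>i. real (count_list w i)) \<in> T"
      proof (rule dominant_nondegenerate_in_convex[OF IV_subset T T_rfl, of \<Lambda> "\<lambda>j. int (n j)"])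
        have "\<Lambda> - comb (\<lambda>i. if i \<in> I - IV then real (count_list w i) else 0) \<in> T"
          using T assms(3) rays by (intro cone_in_convex) auto
        also have "comb (\<lambda>i. if i \<in> I - IV then real (count_list w i) else 0)
            = comb (\<lambda>i. if i \<in> IV then 0 else real (count_list w i))"
          by (intro comb_cong) auto
        finally show "\<Lambda> - comb (\<lambda>i. if i \<in> IV then 0 else real (count_list w i)) \<in> T" .
        show "(\<Sum>i\<in>I. int (count_list w i) * A j i) \<le> int (n j)" if "j \<in> IV" for j
          using False that by (force simp: p_def)
        show False if R: "R \<subseteq> IV" "R \<noteq> {}" "\<And>j. j \<in> R \<Longrightarrow> int (n j) = 0 \<and> 0 < count_list w j \<and>
            (\<forall>k\<in>I - R. 0 < count_list w k \<longrightarrow> A j k = 0)" for R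
        proof -
          have set: "0 < count_list w k \<longleftrightarrow> k \<in> set w" for k
            by (metis count_list_0_iff neq0_conv)
          have "R \<inter> set w \<noteq> {}" using R(2,3) unfolding set by blast
          moreover have "\<Lambda> (\<alpha>v j) = 0" if "j \<in> R" for j using R(1,3) that L by fastforce
          moreover have "A j k = 0" if "j \<in> R" "k \<in> set w - R" for j k
            using R(3)[OF that(1)] that(2) less.prems(1) unfolding set by auto
          ultimately have "mon w = 0" using mon_degenerate[OF less.prems(1) R(1)] by blast
          then show False using less.prems by simp
        qed
      qed (use L in auto)
      then show ?thesis by (simp add: mwt_def cnt_def[abs_def])
    qed
  qed
  then show ?thesis unfolding subset_iff weights_iff by blast
qed

text \<open>
  The ray from \<open>\<Lambda>\<close> in direction \<open>- \<alpha>\<^sub>i\<close> is a face of the cone that \<open>\<Lambda>\<close> and the negative simple roots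
  span, so that a convex combination of weights on it involves only weights on it.
\<close>

lemma ray_point_not_in_hull:
  assumes "i \<in> IV"
  obtains n where "\<Lambda> - comb (\<lambda>k. if k = i then real n else 0) \<notin> convex hull weights"
proof -
  have i: "i \<in> I" using assms IV_subset by blast
  obtain n where n: "(act (F i) ^^ Suc n) v\<^sub>0 = 0" using IV_integral[OF assms] by blast
  \<comment> \<open>Cone points, cut off beyond \<open>n\<close> on the ray only. A combination with
    positive coefficients lies on the ray only if both points do, so the cut preserves
    convexity.\<close>
  define C where "C = {\<Lambda> - comb c | c. (\<forall>k\<in>I. 0 \<le> c k) \<and> ((\<forall>k\<in>I. k \<noteq> i \<longrightarrow> c k = 0) \<longrightarrow> c i \<le> real n)}"
  have "convex C"
  proof (rule convexI)
    fix \<mu> \<nu> and a b :: real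
    assume \<mu>: "\<mu> \<in> C" and \<nu>: "\<nu> \<in> C" and ab: "0 \<le> a" "0 \<le> b" "a + b = 1"
    from \<mu> obtain c where c: "\<mu> = \<Lambda> - comb c" "\<forall>k\<in>I. 0 \<le> c k"
      "(\<forall>k\<in>I. k \<noteq> i \<longrightarrow> c k = 0) \<longrightarrow> c i \<le> real n" by (auto simp: C_def)
    from \<nu> obtain d where d: "\<nu> = \<Lambda> - comb d" "\<forall>k\<in>I. 0 \<le> d k"
      "(\<forall>k\<in>I. k \<noteq> i \<longrightarrow> d k = 0) \<longrightarrow> d i \<le> real n" by (auto simp: C_def)
    show "a *\<^sub>R \<mu> + b *\<^sub>R \<nu> \<in> C"
    proof (cases "a = 0 \<or> b = 0")
      case True
      then show ?thesis using ab \<mu> \<nu> by auto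
    next
      case False
      let ?e = "\<lambda>k. a * c k + b * d k"
      have "a *\<^sub>R \<mu> + b *\<^sub>R \<nu> = (a + b) *\<^sub>R \<Lambda> - comb ?e"
        by (simp add: c d comb_add comb_scaleR scaleR_diff_right scaleR_add_left)
      then have "a *\<^sub>R \<mu> + b *\<^sub>R \<nu> = \<Lambda> - comb ?e" by (simp add: ab)
      moreover have "\<forall>k\<in>I. 0 \<le> ?e k" using c d ab by auto
      moreover have "?e i \<le> real n" if z: "\<forall>k\<in>I. k \<noteq> i \<longrightarrow> ?e k = 0"
      proof -
        have "c k = 0 \<and> d k = 0" if "k \<in> I" "k \<noteq> i" for k
        proof -
          have "a * c k + b * d k = 0" "0 \<le> a * c k" "0 \<le> b * d k"
            using z that c d ab by auto
          then show ?thesis using False by (simp add: add_nonneg_eq_0_iff)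
        qed
        then have "c i \<le> real n" "d i \<le> real n" using c(3) d(3) by auto
        then have "a * c i + b * d i \<le> a * real n + b * real n"
          using ab by (intro add_mono mult_left_mono) auto
        also have "\<dots> = real n" using ab by (simp flip: distrib_right)
        finally show ?thesis .
      qed
      ultimately show ?thesis unfolding C_def by blast
    qed
  qed
  moreover have "weights \<subseteq> C"
  proof
    fix \<mu> assume "\<mu> \<in> weights"
    then obtain w where w: "w \<in> lists I" "mwt w = \<mu>" "mon w \<noteq> 0" by (auto simp: weights_iff)
    have "cnt w i \<le> real n" if "\<forall>k\<in>I. k \<noteq> i \<longrightarrow> cnt w k = 0"
    proof -
      have "k = i" if "k \<in> set w" for k
        using that \<open>\<forall>k\<in>I. k \<noteq> i \<longrightarrow> cnt w k = 0\<close> w(1) by (auto simp: cnt_def count_list_0_iff)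
      then have rep: "w = replicate (length w) i" by (simp add: replicate_length_same[symmetric])
      have "length w \<le> n"
      proof (rule ccontr)
        assume "\<not> length w \<le> n"
        then have "(act (F i) ^^ length w) v\<^sub>0 = (act (F i) ^^ (length w - Suc n)) ((act (F i) ^^ Suc n) v\<^sub>0)"
          by (metis funpow_add not_less_eq_eq le_add_diff_inverse2 o_apply)
        then have "mon (replicate (length w) i) = 0" unfolding mon_replicate n by simp
        then show False using w(3) rep by simp
      qed
      then show ?thesis using count_le_length[of w i] by (simp add: cnt_def)
    qed
    then show "\<mu> \<in> C" unfolding C_def using w(2) by (auto simp: mwt_def cnt_def intro!: exI[of _ "cnt w"])
  qed
  ultimately have hull: "convex hull weights \<subseteq> C" by (intro hull_minimal)
  have "\<Lambda> - comb (\<lambda>k. if k = i then real (Suc n) else 0) \<notin> C"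
  proof
    assume "\<Lambda> - comb (\<lambda>k. if k = i then real (Suc n) else 0) \<in> C"
    then obtain c where c: "\<Lambda> - comb (\<lambda>k. if k = i then real (Suc n) else 0) = \<Lambda> - comb c"
      "(\<forall>k\<in>I. k \<noteq> i \<longrightarrow> c k = 0) \<longrightarrow> c i \<le> real n" unfolding C_def by blast
    then have "comb (\<lambda>k. if k = i then real (Suc n) else 0) = comb c" by simp
    from comb_inject[OF this] have "\<forall>k\<in>I. c k = (if k = i then real (Suc n) else 0)" by simp
    then show False using c(2) i by simp
  qed
  then show thesis using that hull by blast
qed

section \<open>The stabilizer of the character\<close>

lemma character_apply: "\<mu> \<in> dualh \<Longrightarrow> character sh H sV act \<mu> = V.dim (Wt \<mu>)"
  by (simp add: character_def)

lemma char_action_wact: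
  assumes "w \<in> lists I" "\<mu> \<in> dualh"
  shows "char_action sh (restrict (wact w) dualh) ch (wact w \<mu>) = ch \<mu>"
proof -
  have "inj_on (restrict (wact w) dualh) dualh"
    using wact_bij[OF assms(1)] by (simp add: bij_betw_def)
  then have "inv_into dualh (restrict (wact w) dualh) (restrict (wact w) dualh \<mu>) = \<mu>"
    using assms(2) by (rule inv_into_f_f)
  then show ?thesis using assms wact_dual by (simp add: char_action_def)
qed

theorem stabilizer_eq_parabolic:
  "char_stabilizer I sh \<alpha> \<alpha>v (character sh H sV act) = weyl_group sh \<alpha> \<alpha>v IV"
proof (intro equalityI subsetI)
  fix f assume "f \<in> weyl_group sh \<alpha> \<alpha>v IV"
  then obtain w where w: "w \<in> lists IV" "f = restrict (wact w) dualh"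
    using weyl_group_words[OF IV_subset] by blast
  have wI: "w \<in> lists I" using w(1) IV_subset by auto
  have "char_action sh f (character sh H sV act) \<mu> = character sh H sV act \<mu>" for \<mu>
  proof (cases "\<mu> \<in> dualh")
    case True
    define \<nu> where "\<nu> = wact (rev w) \<mu>"
    have \<nu>: "\<nu> \<in> dualh" "\<mu> = wact w \<nu>"
      using True wI wact_rev'[OF wI] wact_dual[of "rev w" \<mu>] by (auto simp: \<nu>_def in_lists_conv_set)
    have "char_action sh f (character sh H sV act) \<mu> = character sh H sV act \<nu>"
      unfolding w(2) \<nu>(2) by (rule char_action_wact[OF wI \<nu>(1)])
    also have "\<dots> = character sh H sV act \<mu>"
      using True \<nu> dim_Wt_wact[OF w(1), of \<nu>] by (simp add: character_apply)
    finally show ?thesis .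
  qed (simp add: char_action_def character_def)
  moreover have "f \<in> weyl_group sh \<alpha> \<alpha>v I"
    using w(2) wI weyl_group_words[OF subset_refl] by blast
  ultimately show "f \<in> char_stabilizer I sh \<alpha> \<alpha>v (character sh H sV act)"
    by (auto simp: char_stabilizer_def)
next
  fix f assume "f \<in> char_stabilizer I sh \<alpha> \<alpha>v (character sh H sV act)"
  then have "f \<in> weyl_group sh \<alpha> \<alpha>v I"
    and stab: "char_action sh f (character sh H sV act) = character sh H sV act"
    by (auto simp: char_stabilizer_def)
  then obtain w where w: "w \<in> lists I" "f = restrict (wact w) dualh"
    using weyl_group_words[OF subset_refl] by blast
  have w_weights: "wact w \<mu> \<in> weights" if "\<mu> \<in> weights" for \<mu>
  proof -
    have \<mu>: "\<mu> \<in> dualh" "wact w \<mu> \<in> dualh" using that weights_dual wact_dual[OF w(1)] by auto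
    have "character sh H sV act (wact w \<mu>) = character sh H sV act \<mu>"
      using char_action_wact[OF w(1) \<mu>(1), of "character sh H sV act"] stab w(2) by simp
    then show ?thesis using that \<mu> dim_Wt_pos by (simp add: character_apply)
  qed
  obtain u where u: "u \<in> lists IV" "\<And>j. j \<in> IV \<Longrightarrow> wact (w @ u) (\<alpha> j) \<in> Qpos"
    using minimal_coset_representative[OF w(1) IV_subset] by blast
  have uI: "u \<in> lists I" using u(1) IV_subset by auto
  have u_weights: "wact u \<mu> \<in> weights" if "\<mu> \<in> weights" for \<mu>
    using u(1) that by (induction u) (auto simp: weights_rfl)
  have "wact (w @ u) (\<alpha> i) \<in> Qpos" if i: "i \<in> I" for i
  proof (cases "i \<in> IV")
    case False
    let ?g = "wact (w @ u)"
    have "\<exists>c. (\<forall>k\<in>I. 0 \<le> c k) \<and> ?g (\<Lambda> - fscale (of_nat n) (\<alpha> i)) = \<Lambda> - comb c" for n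
    proof -
      have "\<Lambda> - fscale (of_nat n) (\<alpha> i) \<in> weights"
        using string_weights[OF i False, of n] by (simp add: comb_single[OF i])
      then have "?g (\<Lambda> - fscale (of_nat n) (\<alpha> i)) \<in> weights"
        using w_weights u_weights by simp
      then obtain v where "mwt v = ?g (\<Lambda> - fscale (of_nat n) (\<alpha> i))" by (auto simp: weights_iff)
      then show ?thesis by (intro exI[of _ "cnt v"]) (auto simp: mwt_def cnt_def)
    qed
    then have "\<forall>n. \<exists>c. (\<forall>k\<in>I. 0 \<le> c k) \<and> ?g \<Lambda> - fscale (of_nat n) (?g (\<alpha> i)) = \<Lambda> - comb c"
      unfolding wact_diff wact_fscale by blast
    from choice[OF this] obtain c where c: "\<And>n k. k \<in> I \<Longrightarrow> 0 \<le> c n k"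
      "\<And>n. ?g \<Lambda> - fscale (of_nat n) (?g (\<alpha> i)) = \<Lambda> - comb (c n)"
      by blast
    have ch: "?g \<Lambda> h - of_nat n * ?g (\<alpha> i) h = \<Lambda> h - comb (c n) h" for n h
      using fun_cong[OF c(2)[of n], of h] by (simp only: minus_apply fscale_apply)
    \<comment> \<open>The coefficients of the image of \<open>\<alpha> i\<close>, read off from the
      first two points of the image ray. Then \<open>c n\<close> is affine in \<open>n\<close> with
      slope \<open>d\<close>, and being nonnegative for all \<open>n\<close> it forces
      \<open>d\<close> to be nonnegative.\<close>
    define d where "d k = c 1 k - c 0 k" for k
    have "comb d = comb (c 1) - comb (c 0)"
      unfolding d_def by (rule comb_diff)
    then have d: "comb d h = comb (c 1) h - comb (c 0) h" for h by simp
    have gd: "?g (\<alpha> i) = comb d"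
    proof
      fix h
      have "?g \<Lambda> h - ?g (\<alpha> i) h = \<Lambda> h - comb (c 1) h" "?g \<Lambda> h = \<Lambda> h - comb (c 0) h"
        using ch[of h 1] ch[of h 0] by simp_all
      then show "?g (\<alpha> i) h = comb d h" using d[of h] by algebra
    qed
    have cn: "c n k = c 0 k + real n * d k" if "k \<in> I" for n k
    proof -
      have "comb (c n) = comb (\<lambda>k. c 0 k + real n * d k)"
      proof
        fix h
        have "comb (c n) h = \<Lambda> h - ?g \<Lambda> h + of_nat n * comb d h"
          using ch[of h n] unfolding gd by (simp add: algebra_simps)
        also have "\<Lambda> h - ?g \<Lambda> h = comb (c 0) h" using ch[of h 0] by simp
        finally show "comb (c n) h = comb (\<lambda>k. c 0 k + real n * d k) h"
          by (simp add: comb_add comb_scaleR scaleR_fun_def scaleR_conv_of_real)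
      qed
      from comb_inject[OF this that] show ?thesis .
    qed
    have "0 \<le> d k" if k: "k \<in> I" for k
    proof (rule ccontr)
      assume "\<not> 0 \<le> d k"
      then obtain n where "c 0 k < real n * (- d k)"
        using reals_Archimedean3[of "- d k"] by auto
      then have "c n k < 0" using cn[OF k, of n] by simp
      then show False using c(1)[OF k, of n] by simp
    qed
    then show ?thesis using gd by (auto simp: Qpos_def)
  qed (use u in blast)
  then have id: "wact (w @ u) = id"
    using word_trivial[of "w @ u"] w(1) uI by auto
  have "wact w \<mu> = wact (rev u) \<mu>" for \<mu>
    using fun_cong[OF id, of "wact (rev u) \<mu>"] wact_rev'[OF uI] by simp
  then have "f = restrict (wact (rev u)) dualh" using w(2) by (simp add: fun_eq_iff)
  moreover have "rev u \<in> lists IV" using u(1) by (auto simp: in_lists_conv_set)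
  ultimately show "f \<in> weyl_group sh \<alpha> \<alpha>v IV" using weyl_group_words[OF IV_subset] by blast
qed

end

section \<open>Comparison of modules with the same highest weight\<close>

text \<open>The hull for the second module is convex, invariant under the common reflections and
  contains the rays, so \<open>weights_in_convex\<close> applies to it.\<close>

lemma weights_subset_hull:
  assumes "km_highest_weight_module I A sh \<alpha> \<alpha>v sg br H E F sV aV \<Lambda> v"
    and "km_highest_weight_module I A sh \<alpha> \<alpha>v sg br H E F sV' aV' \<Lambda> v'"
    and "integrability I F aV = integrability I F aV'"
  shows "wt sh H sV aV \<subseteq> convex hull wt sh H sV' aV'"
proof -
  interpret V: km_highest_weight_module I A sh \<alpha> \<alpha>v sg br H E F sV aV \<Lambda> v by fact
  interpret V': km_highest_weight_module I A sh \<alpha> \<alpha>v sg br H E F sV' aV' \<Lambda> v' by fact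
  show ?thesis
  proof (rule V.weights_in_convex)
    show "V.rfl j \<mu> \<in> convex hull wt sh H sV' aV'"
      if "j \<in> integrability I F aV" "\<mu> \<in> convex hull wt sh H sV' aV'" for j \<mu>
      using that V'.weights_rfl assms(3) by (intro V.convex_hull_rfl) auto
  qed (use V'.\<Lambda>_weight V'.string_weights assms(3) in \<open>auto intro: hull_inc\<close>)
qed

text \<open>If \<open>i\<close> is integrable for one module only, the whole ray consists of weights
  of the other module but leaves the hull of the first.\<close>

lemma hull_eq_iff_integrability_eq:
  assumes V: "km_highest_weight_module I A sh \<alpha> \<alpha>v sg br H E F sV aV \<Lambda> v"
    and V': "km_highest_weight_module I A sh \<alpha> \<alpha>v sg br H E F sV' aV' \<Lambda> v'"
  shows "convex hull wt sh H sV aV = convex hull wt sh H sV' aV' \<longleftrightarrow>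
    integrability I F aV = integrability I F aV'"
proof
  assume "integrability I F aV = integrability I F aV'"
  then show "convex hull wt sh H sV aV = convex hull wt sh H sV' aV'"
    using weights_subset_hull[OF V V'] weights_subset_hull[OF V' V]
    by (intro equalityI hull_minimal) auto
next
  interpret V: km_highest_weight_module I A sh \<alpha> \<alpha>v sg br H E F sV aV \<Lambda> v by fact
  interpret V': km_highest_weight_module I A sh \<alpha> \<alpha>v sg br H E F sV' aV' \<Lambda> v' by fact
  assume hull: "convex hull wt sh H sV aV = convex hull wt sh H sV' aV'"
  show "integrability I F aV = integrability I F aV'"
  proof (intro equalityI subsetI)
    fix i assume i: "i \<in> integrability I F aV"
    show "i \<in> integrability I F aV'"
    proof (rule ccontr)
      assume "i \<notin> integrability I F aV'"
      then have "\<Lambda> - V.comb (\<lambda>k. if k = i then real n else 0) \<in> convex hull wt sh H sV' aV'" for n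
        using V'.string_weights V.IV_subset i by (blast intro: hull_inc)
      then show False using V.ray_point_not_in_hull[OF i] hull by metis
    qed
  next
    fix i assume i: "i \<in> integrability I F aV'"
    show "i \<in> integrability I F aV"
    proof (rule ccontr)
      assume "i \<notin> integrability I F aV"
      then have "\<Lambda> - V.comb (\<lambda>k. if k = i then real n else 0) \<in> convex hull wt sh H sV aV" for n
        using V.string_weights V'.IV_subset i by (blast intro: hull_inc)
      then show False using V'.ray_point_not_in_hull[OF i] hull by metis
    qed
  qed
qed

section \<open>The parabolic Verma module\<close>

context km_highest_weight_module
begin

text \<open>The universal property of the Verma module: its relations hold at
  \<open>v\<^sub>0\<close>, so evaluation there factors through it.\<close>

lemma mod_cong_sound:
  assumes "mod_cong sg br (verma_rels I H E \<Lambda>) s t"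
  shows "mod_eval sV act v\<^sub>0 s = mod_eval sV act v\<^sub>0 t"
  using assms
proof (induction rule: mod_cong.induct)
  case (rel s t)
  then show ?case using e_v0 v0_weight by (auto simp: verma_rels_def Wt_iff)
qed (auto simp: V.act_add_left V.act_scale_left V.act_add_right V.act_scale_right V.act_br
    V.scale_right_distrib V.scale_left_distrib algebra_simps)

text \<open>
  Since \<open>V\<close> satisfies the defining relations of the parabolic Verma module, the kernel of the
  projection from the Verma module is contained in the kernel \<open>K\<close> of evaluation in \<open>V\<close>.
\<close>

lemma parabolic_verma:
  assumes "parabolic_verma_module I \<alpha>v sg br H E F \<Lambda> IV sM aM sP aP"
  shows "\<exists>p. km_highest_weight_module I A sh \<alpha> \<alpha>v sg br H E F sP aP \<Lambda> p \<and> integrability I F aP = IV"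
proof -
  interpret P: parabolic_verma_module I \<alpha>v sg br H E F \<Lambda> IV sM aM sP aP by fact
  interpret KM: km_module I A sh \<alpha> \<alpha>v sg br H E F sM aM ..
  interpret KP: km_module I A sh \<alpha> \<alpha>v sg br H E F sP aP ..
  obtain m where m: "surj (mod_eval sM aM m)" "\<And>s t. mod_eval sM aM m s = mod_eval sM aM m t
      \<longleftrightarrow> mod_cong sg br (verma_rels I H E \<Lambda>) s t"
    using P.verma.presented by blast
  let ?gen = "{(aM (F j) ^^ (n + 1)) x | j n x. j \<in> IV \<and> \<Lambda> (\<alpha>v j) = of_nat n \<and> x \<in> weight_space H sM aM \<Lambda>}"
  obtain \<pi> where \<pi>: "Vector_Spaces.linear sM sP \<pi>" "surj \<pi>" "\<And>x y. \<pi> (aM x y) = aP x (\<pi> y)"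
    "{y. \<pi> y = 0} = submodule sM aM hull ?gen"
    using P.quotient by blast
  interpret \<pi>: Vector_Spaces.linear sM sP \<pi> by (rule \<pi>(1))
  have eval: "mod_eval sV act v\<^sub>0 s = mod_eval sV act v\<^sub>0 t" if "mod_eval sM aM m s = mod_eval sM aM m t" for s t
    using that m(2) mod_cong_sound by blast
  have \<pi>_pow: "\<pi> ((aM x ^^ n) y) = (aP x ^^ n) (\<pi> y)" for x n y
    by (induction n) (simp_all add: \<pi>(3))
  have eval_pow: "mod_eval s a x ((MAct y ^^ n) t) = (a y ^^ n) (mod_eval s a x t)"
    for s :: "complex \<Rightarrow> 'x \<Rightarrow> 'x::ab_group_add" and a x y n t
    by (induction n) simp_all
  have m_e: "aM (E i) m = 0" if "i \<in> I" for i
  proof -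
    have "mod_cong sg br (verma_rels I H E \<Lambda>) (MAct (E i) MGen) MZero"
      using that by (intro mod_cong.rel) (auto simp: verma_rels_def)
    then show ?thesis using m(2)[of "MAct (E i) MGen" MZero] by simp
  qed
  have m_h: "m \<in> weight_space H sM aM \<Lambda>"
  proof -
    have "mod_cong sg br (verma_rels I H E \<Lambda>) (MAct (H h) MGen) (MScale (\<Lambda> h) MGen)" for h
      by (intro mod_cong.rel) (auto simp: verma_rels_def)
    then show ?thesis using m(2)[of "MAct (H _) MGen" "MScale (\<Lambda> _) MGen"] by (simp add: KM.Wt_iff)
  qed
  \<comment> \<open>The kernel of the map from the Verma module to \<open>V\<close>, described
    through terms. By \<open>K_iff\<close> membership does not depend on the chosen term.\<close>
  define K where "K = {mod_eval sM aM m t | t. mod_eval sV act v\<^sub>0 t = 0}"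
  have KI: "mod_eval sM aM m t \<in> K" if "mod_eval sV act v\<^sub>0 t = 0" for t using that by (auto simp: K_def)
  have K_iff: "mod_eval sM aM m t \<in> K \<longleftrightarrow> mod_eval sV act v\<^sub>0 t = 0" for t
  proof
    assume "mod_eval sM aM m t \<in> K"
    then obtain t' where "mod_eval sM aM m t = mod_eval sM aM m t'" "mod_eval sV act v\<^sub>0 t' = 0"
      unfolding K_def by blast
    then show "mod_eval sV act v\<^sub>0 t = 0" using eval[of t t'] by simp
  qed (rule KI)
  have "P.verma.subspace K"
  proof (rule P.verma.subspaceI)
    show "0 \<in> K" using KI[of MZero] by simp
  next
    fix x y assume "x \<in> K" "y \<in> K"
    then obtain s t where "x = mod_eval sM aM m s" "mod_eval sV act v\<^sub>0 s = 0"
      "y = mod_eval sM aM m t" "mod_eval sV act v\<^sub>0 t = 0" by (auto simp: K_def)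
    then show "x + y \<in> K" using KI[of "MPlus s t"] by simp
  next
    fix c x assume "x \<in> K"
    then obtain s where "x = mod_eval sM aM m s" "mod_eval sV act v\<^sub>0 s = 0" by (auto simp: K_def)
    then show "sM c x \<in> K" using KI[of "MScale c s"] by simp
  qed
  moreover have "aM y x \<in> K" if x: "x \<in> K" for x y
  proof -
    obtain s where "x = mod_eval sM aM m s" "mod_eval sV act v\<^sub>0 s = 0" using x by (auto simp: K_def)
    then show ?thesis using KI[of "MAct y s"] by simp
  qed
  ultimately have "submodule sM aM K" by (simp add: submodule_def)
  moreover have "?gen \<subseteq> K"
  proof
    fix y assume "y \<in> ?gen"
    then obtain j n x where y: "y = (aM (F j) ^^ (n + 1)) x" "j \<in> IV" "\<Lambda> (\<alpha>v j) = of_nat n"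
      "x \<in> weight_space H sM aM \<Lambda>" by blast
    obtain t where t: "x = mod_eval sM aM m t" using m(1) by (metis surjD)
    have "mod_eval sV act v\<^sub>0 t \<in> Wt \<Lambda>"
      unfolding Wt_iff
    proof
      fix h
      have "mod_eval sM aM m (MAct (H h) t) = mod_eval sM aM m (MScale (\<Lambda> h) t)"
        using y(4) t by (simp add: KM.Wt_iff)
      from eval[OF this] show "act (H h) (mod_eval sV act v\<^sub>0 t) = sV (\<Lambda> h) (mod_eval sV act v\<^sub>0 t)"
        by simp
    qed
    \<comment> \<open>The highest weight space of \<open>V\<close> is a line, so a generator of the
      kernel evaluates to a multiple of a vanishing power applied to
      \<open>v\<^sub>0\<close>.\<close>
    then obtain c where c: "mod_eval sV act v\<^sub>0 t = sV c v\<^sub>0"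
      unfolding Wt_\<Lambda> V.span_singleton by blast
    obtain n' where n': "\<Lambda> (\<alpha>v j) = of_nat n'" "(act (F j) ^^ Suc n') v\<^sub>0 = 0"
      using IV_integral[OF y(2)] by blast
    have "n = n'" using y(3) n'(1) by simp
    then have "(act (F j) ^^ (n + 1)) v\<^sub>0 = 0" using n'(2) by simp
    then have "mod_eval sV act v\<^sub>0 ((MAct (F j) ^^ (n + 1)) t) = 0"
      unfolding eval_pow c act_pow_scale by simp
    from KI[OF this] show "y \<in> K" unfolding eval_pow y(1) t .
  qed
  ultimately have ker: "{y. \<pi> y = 0} \<subseteq> K" unfolding \<pi>(4) by (intro hull_minimal)
  define p where "p = \<pi> m"
  have "p \<noteq> 0"
  proof
    assume "p = 0"
    then have "mod_eval sM aM m MGen \<in> K" using ker by (auto simp: p_def)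
    then show False unfolding K_iff using v0_nonzero by simp
  qed
  moreover have "aP (E i) p = 0" if "i \<in> I" for i
    using m_e[OF that] \<pi>(3)[of "E i" m] \<pi>.zero by (simp add: p_def)
  moreover have "p \<in> weight_space H sP aP \<Lambda>"
    using m_h by (simp add: KM.Wt_iff KP.Wt_iff p_def \<pi>.scale flip: \<pi>(3))
  moreover have "submodule sP aP hull {p} = UNIV"
  proof -
    have "x \<in> N" if N: "submodule sP aP N" "p \<in> N" for x N
    proof -
      have "\<pi> (mod_eval sM aM m t) \<in> N" for t
        using N by (induction t) (auto simp: p_def submodule_def \<pi>.zero \<pi>.add \<pi>.scale \<pi>(3)
            intro: P.subspace_0 P.subspace_add P.subspace_scale)
      moreover obtain t where "x = \<pi> (mod_eval sM aM m t)" using m(1) \<pi>(2) by (metis surjD)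
      ultimately show ?thesis by simp
    qed
    then show ?thesis by (auto simp: hull_def)
  qed
  ultimately have P: "km_highest_weight_module I A sh \<alpha> \<alpha>v sg br H E F sP aP \<Lambda> p"
    using \<Lambda>_dual by unfold_locales auto
  interpret HP: km_highest_weight_module I A sh \<alpha> \<alpha>v sg br H E F sP aP \<Lambda> p by (rule P)
  have "integrability I F aP = IV"
  proof (intro equalityI subsetI)
    fix i assume "i \<in> integrability I F aP"
    then obtain n where i: "i \<in> I" and n: "(aP (F i) ^^ n) p = 0" using HP.IV_iff by blast
    \<comment> \<open>A power that kills \<open>p\<close> lifts into the kernel of
      \<open>\<pi>\<close>, hence into \<open>K\<close>, and so kills \<open>v\<^sub>0\<close> as
      well.\<close>
    have "\<pi> ((aM (F i) ^^ n) m) = 0" using n by (simp add: p_def \<pi>_pow)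
    then have "mod_eval sM aM m ((MAct (F i) ^^ n) MGen) \<in> K" using ker by (auto simp: eval_pow)
    then have "(act (F i) ^^ n) v\<^sub>0 = 0"
      using K_iff[of "(MAct (F i) ^^ n) MGen"] by (simp add: eval_pow)
    then show "i \<in> IV" using i IV_iff by blast
  next
    fix i assume i: "i \<in> IV"
    obtain n where "\<Lambda> (\<alpha>v i) = of_nat n" using IV_integral[OF i] by blast
    then have "(aM (F i) ^^ (n + 1)) m \<in> ?gen" using i m_h by blast
    then have "(aM (F i) ^^ (n + 1)) m \<in> {y. \<pi> y = 0}" unfolding \<pi>(4) by (rule hull_inc)
    then have "(aP (F i) ^^ (n + 1)) p = 0" by (simp add: p_def \<pi>_pow del: funpow.simps)
    then show "i \<in> integrability I F aP" using i IV_subset HP.IV_iff by blast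
  qed
  then show ?thesis using P by blast
qed

end

lemma km_highest_weight_moduleI:
  assumes "kac_moody_algebra I A sh \<alpha> \<alpha>v sg br H E F" and "\<Lambda> \<in> dual sh"
    and "highest_weight_module I sg br H E \<Lambda> sV act"
  shows "\<exists>v. km_highest_weight_module I A sh \<alpha> \<alpha>v sg br H E F sV act \<Lambda> v"
proof -
  interpret kac_moody_algebra I A sh \<alpha> \<alpha>v sg br H E F by fact
  interpret V: highest_weight_module I sg br H E \<Lambda> sV act by fact
  obtain v where "v \<noteq> 0 \<and> (\<forall>i\<in>I. act (E i) v = 0) \<and> v \<in> weight_space H sV act \<Lambda>
         \<and> submodule sV act hull {v} = UNIV"
    using V.highest_weight_vector by blast
  then have "km_highest_weight_module I A sh \<alpha> \<alpha>v sg br H E F sV act \<Lambda> v"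
    using assms(2) by unfold_locales auto
  then show ?thesis by blast
qed

theorem theorem2p9:
  fixes I :: "'i set" and A :: "'i \<Rightarrow> 'i \<Rightarrow> int"
    and sh :: "complex \<Rightarrow> 'h \<Rightarrow> 'h::ab_group_add"
    and \<alpha> :: "'i \<Rightarrow> 'h \<Rightarrow> complex" and \<alpha>v :: "'i \<Rightarrow> 'h"
    and sg :: "complex \<Rightarrow> 'g \<Rightarrow> 'g::ab_group_add" and br :: "'g \<Rightarrow> 'g \<Rightarrow> 'g"
    and H :: "'h \<Rightarrow> 'g" and E :: "'i \<Rightarrow> 'g" and F :: "'i \<Rightarrow> 'g"
    and \<Lambda> :: "'h \<Rightarrow> complex"
    and sV :: "complex \<Rightarrow> 'v \<Rightarrow> 'v::ab_group_add" and aV :: "'g \<Rightarrow> 'v \<Rightarrow> 'v"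
    and sV' :: "complex \<Rightarrow> 'w \<Rightarrow> 'w::ab_group_add" and aV' :: "'g \<Rightarrow> 'w \<Rightarrow> 'w"
  assumes "kac_moody_algebra I A sh \<alpha> \<alpha>v sg br H E F"
    and "\<Lambda> \<in> dual sh"
    and "highest_weight_module I sg br H E \<Lambda> sV aV"
    and "highest_weight_module I sg br H E \<Lambda> sV' aV'"
  shows
    "(integrability I F aV = integrability I F aV'
        \<longleftrightarrow> convex hull (wt sh H sV aV) = convex hull (wt sh H sV' aV'))
     \<and> (convex hull (wt sh H sV aV) = convex hull (wt sh H sV' aV')
        \<longleftrightarrow> char_stabilizer I sh \<alpha> \<alpha>v (character sh H sV aV)
            = char_stabilizer I sh \<alpha> \<alpha>v (character sh H sV' aV'))
     \<and> (integrability I F aV = integrability I F aV'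
        \<longleftrightarrow> char_stabilizer I sh \<alpha> \<alpha>v (character sh H sV aV)
            = char_stabilizer I sh \<alpha> \<alpha>v (character sh H sV' aV'))
     \<and> (\<forall>(sM :: complex \<Rightarrow> 'm \<Rightarrow> 'm::ab_group_add) aM (sP :: complex \<Rightarrow> 'p \<Rightarrow> 'p::ab_group_add) aP.
          parabolic_verma_module I \<alpha>v sg br H E F \<Lambda> (integrability I F aV) sM aM sP aP
            \<longrightarrow> convex hull (wt sh H sV aV) = convex hull (wt sh H sP aP))
     \<and> char_stabilizer I sh \<alpha> \<alpha>v (character sh H sV aV)
         = weyl_group sh \<alpha> \<alpha>v (integrability I F aV)"
proof -
  obtain v where V: "km_highest_weight_module I A sh \<alpha> \<alpha>v sg br H E F sV aV \<Lambda> v"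
    using km_highest_weight_moduleI[OF assms(1-3)] by blast
  obtain v' where V': "km_highest_weight_module I A sh \<alpha> \<alpha>v sg br H E F sV' aV' \<Lambda> v'"
    using km_highest_weight_moduleI[OF assms(1,2,4)] by blast
  interpret V: km_highest_weight_module I A sh \<alpha> \<alpha>v sg br H E F sV aV \<Lambda> v by (rule V)
  interpret V': km_highest_weight_module I A sh \<alpha> \<alpha>v sg br H E F sV' aV' \<Lambda> v' by (rule V')
  have hull: "convex hull (wt sh H sV aV) = convex hull (wt sh H sV' aV')
      \<longleftrightarrow> integrability I F aV = integrability I F aV'"
    by (rule hull_eq_iff_integrability_eq[OF V V'])
  have stab: "char_stabilizer I sh \<alpha> \<alpha>v (character sh H sV aV)
      = char_stabilizer I sh \<alpha> \<alpha>v (character sh H sV' aV')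
      \<longleftrightarrow> integrability I F aV = integrability I F aV'"
    unfolding V.stabilizer_eq_parabolic V'.stabilizer_eq_parabolic
    using V.parabolic_subgroup_inject[OF V.IV_subset V'.IV_subset] by metis
  \<comment> \<open>By \<open>parabolic_verma\<close> this module has the same integrability as
    \<open>V\<close>, so the comparison of hulls applies to it.\<close>
  have verma: "convex hull (wt sh H sV aV) = convex hull (wt sh H sP aP)"
    if "parabolic_verma_module I \<alpha>v sg br H E F \<Lambda> (integrability I F aV) sM aM sP aP"
    for sM :: "complex \<Rightarrow> 'm \<Rightarrow> 'm" and aM and sP :: "complex \<Rightarrow> 'p \<Rightarrow> 'p" and aP
    using V.parabolic_verma[OF that] hull_eq_iff_integrability_eq[OF V] by metis
  show ?thesis
    using hull stab verma V.stabilizer_eq_parabolic by simp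
qed

end
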